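(* Assume that $\boldsymbol{A}$ is drawn from the inhomogeneous random graph model with connection probability matrix $\boldsymbol{\Theta}^*$, that for all $1\le i<j\le n$ $$0<\gamma_n\le \boldsymbol{\Theta}^*_{ij}\le \rho_n<1,$$ and that $\rho_n=\omega(n^{-1})$. Let $\widehat{\boldsymbol{\Theta}}$ be the restricted maximum likelihood estimator with $k$ communities and entries in $[\gamma_n,\rho_n]$ and let $\widetilde{\boldsymbol{\Theta}}$ be the oracle matrix (both defined in the context). Then there exist absolute constants $C,C'>0$ such that, with probability at least $1-9\exp(-C\rho_n n\log(k))$, $$\Vert \boldsymbol{\Theta}^{*}-\widehat{\boldsymbol{\Theta}}\Vert^{2}_{2,\boldsymbol{\Pi}}\leq C' \rho_n \left(\mathcal{K}_{\boldsymbol{\Pi}}(\boldsymbol{\Theta}^{*}, \widetilde{\boldsymbol{\Theta}}) + \frac{\rho_n^2}{(1-\rho_n)^2 \wedge \gamma_n^2}\left(k^2 + n\log(k) \right)\right).$$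
   Context: Quantities depend on the number of nodes $n$; $k\ge1$ is an integer that may depend on $n$. $a_n=\omega(b_n)$ means $a_n/b_n\to\infty$. $[k]=\{1,\dots,k\}$; the subscript "sym" denotes symmetric matrices; $a\wedge b=\min(a,b)$. Inhomogeneous random graph model: $\boldsymbol{\Theta}^*\in[0,1]^{n\times n}$ is symmetric with zero diagonal; $\boldsymbol{A}$ is a symmetric $n\times n$ $\{0,1\}$-matrix with zero diagonal whose entries $\boldsymbol{A}_{ij}$, $i<j$, are independent Bernoulli$(\boldsymbol{\Theta}^*_{ij})$. Missing observations: $\boldsymbol{\Pi}\in[0,1]^{n\times n}_{\rm sym}$ is an (unknown) matrix of sampling probabilities; the sampling matrix $\boldsymbol{X}\in\{0,1\}^{n\times n}_{\rm sym}$ has independent entries $\boldsymbol{X}_{ij}\sim$ Bernoulli$(\boldsymbol{\Pi}_{ij})$, $i<j$, and is independent of $\boldsymbol{A}$ (conditionally on $\boldsymbol{\Theta}^*$). $\boldsymbol{X}_{ij}=1$ means that $\boldsymbol{A}_{ij}$ is observed. $\mathcal{K}(q,q')=q\log(q/q')+(1-q)\log\frac{1-q}{1-q'}$ (with $0\log 0=0$) is the Bernoulli Kullback-Leibler divergence, and $\mathcal{K}_{\boldsymbol{B}}(\boldsymbol{M},\boldsymbol{M}')=\sum_{i<j}\boldsymbol{B}_{ij}\mathcal{K}(\boldsymbol{M}_{ij},\boldsymbol{M}'_{ij})$ for symmetric matrices with entries in $[0,1]$. $\Vert \boldsymbol{M}\Vert_{2,\boldsymbol{\Pi}}^2=\sum_{i<j}\boldsymbol{\Pi}_{ij}\boldsymbol{M}_{ij}^2$.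 $\mathcal{Z}_{n,k}$ is the set of label functions $z:[n]\to[k]$. Oracle: $\widetilde{\boldsymbol{\Theta}}_{ij}=\boldsymbol{Q}^*_{z^*(i)z^*(j)}$ for $i\ne j$, $\widetilde{\boldsymbol{\Theta}}_{ii}=0$, where $(\boldsymbol{Q}^*,z^* )\in\arg\min_{\boldsymbol{Q}\in[0,1]^{k\times k}_{\rm sym},\,z\in\mathcal{Z}_{n,k}}\sum_{i<j}\boldsymbol{\Pi}_{ij}\mathcal{K}(\boldsymbol{\Theta}^*_{ij},\boldsymbol{Q}_{z(i)z(j)})$. Restricted maximum likelihood estimator: $\widehat{\boldsymbol{\Theta}}_{ij}=\widehat{\boldsymbol{Q}}_{\widehat z(i)\widehat z(j)}$ for $i\neq j$, $\widehat{\boldsymbol{\Theta}}_{ii}=0$, where $(\widehat{\boldsymbol{Q}},\widehat z)\in\arg\min_{\boldsymbol{Q}\in[\gamma_n,\rho_n]^{k\times k}_{\rm sym},\,z\in\mathcal{Z}_{n,k}}\sum_{i<j}\boldsymbol{X}_{ij}\mathcal{K}(\boldsymbol{A}_{ij},\boldsymbol{Q}_{z(i)z(j)})$. *)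

theory Defs
  imports "HOL-Probability.Probability" "HOL-Probability.Product_PMF"
begin

text \<open>
  Matrices are functions on indices starting at 1; only the entries with indices up to the
  relevant size are meaningful.
\<close>

type_synonym rmat = "nat \<Rightarrow> nat \<Rightarrow> real"

definition sym_mats :: "nat \<Rightarrow> real set \<Rightarrow> rmat set" where
  "sym_mats n S = {M. \<forall>i\<in>{1..n}. \<forall>j\<in>{1..n}. M i j \<in> S \<and> M i j = M j i}"

definition node_pairs :: "nat \<Rightarrow> (nat \<times> nat) set" where
  "node_pairs n = {(i, j). 1 \<le> i \<and> i < j \<and> j \<le> n}"

definition labellings :: "nat \<Rightarrow> nat \<Rightarrow> (nat \<Rightarrow> nat) set" where
  "labellings n k = {1..n} \<rightarrow> {1..k}"


text \<open>
  The law of a symmetric 0/1 matrix with zero diagonal whose entries above the diagonal are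
  independent Bernoulli variables with the given parameters. The default value False of the
  product distribution yields the zero diagonal.
\<close>

definition bernoulli_sym_pmf :: "nat \<Rightarrow> rmat \<Rightarrow> rmat pmf" where
  "bernoulli_sym_pmf n P =
     map_pmf (\<lambda>x i j. of_bool (x (min i j, max i j)))
       (Pi_pmf (node_pairs n) False (\<lambda>(i, j). bernoulli_pmf (P i j)))"

lemma finite_node_pairs [simp]: "finite (node_pairs n)"
proof (rule finite_subset)
  show "node_pairs n \<subseteq> {1..n} \<times> {1..n}"
    by (auto simp: node_pairs_def)
qed simp

lemma bernoulli_sym_pmf_support:
  assumes "M \<in> set_pmf (bernoulli_sym_pmf n P)"
  shows "M i j \<in> {0, 1}" "M i j = M j i" "M i i = 0"
proof -
  obtain x where x: "x \<in> set_pmf (Pi_pmf (node_pairs n) False (\<lambda>(i, j). bernoulli_pmf (P i j)))"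
    and M: "M = (\<lambda>i j. of_bool (x (min i j, max i j)))"
    using assms by (auto simp: bernoulli_sym_pmf_def)
  show "M i j \<in> {0, 1}" by (simp add: M)
  show "M i j = M j i" by (simp add: M min.commute max.commute)
  have "(i, i) \<notin> node_pairs n" by (simp add: node_pairs_def)
  hence "x (i, i) = False" using x by (auto simp: set_Pi_pmf PiE_dflt_def)
  thus "M i i = 0" by (simp add: M)
qed

lemma bernoulli_sym_pmf_marginal:
  assumes "(i, j) \<in> node_pairs n"
  shows "map_pmf (\<lambda>M. M i j) (bernoulli_sym_pmf n P) = map_pmf of_bool (bernoulli_pmf (P i j))"
proof -
  have "min i j = i" "max i j = j" using assms by (auto simp: node_pairs_def)
  hence "map_pmf (\<lambda>M. M i j) (bernoulli_sym_pmf n P) =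
    map_pmf of_bool (map_pmf (\<lambda>x. x (i, j))
      (Pi_pmf (node_pairs n) False (\<lambda>(i, j). bernoulli_pmf (P i j))))"
    by (simp add: bernoulli_sym_pmf_def pmf.map_comp o_def)
  thus ?thesis using assms by (simp add: Pi_pmf_component)
qed

text \<open>
  Joint law of the adjacency matrix and the (independent) sampling matrix. The diagonal of the
  sampling matrix is set to zero; it never enters any sum below.
\<close>

definition observation_pmf :: "nat \<Rightarrow> rmat \<Rightarrow> rmat \<Rightarrow> (rmat \<times> rmat) pmf" where
  "observation_pmf n Theta P = pair_pmf (bernoulli_sym_pmf n Theta) (bernoulli_sym_pmf n P)"


text \<open>
  One summand \<open>a log (a / b)\<close> of the Kullback-Leibler divergence, for nonnegative \<open>a\<close> and \<open>b\<close>.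
  It has to be extended-real valued because \<open>ln 0 = 0\<close> and \<open>a / 0 = 0\<close> in the library,
  which would make parameters 0 and 1 spuriously attractive in the minimisation defining the
  oracle.
\<close>

definition kl_term :: "real \<Rightarrow> real \<Rightarrow> ereal" where
  "kl_term a b = (if a = 0 then 0 else if b = 0 then \<infinity> else ereal (a * ln (a / b)))"

definition kl_bernoulli :: "real \<Rightarrow> real \<Rightarrow> ereal" where
  "kl_bernoulli q q' = kl_term q q' + kl_term (1 - q) (1 - q')"

text \<open>Pairs of weight zero contribute nothing, since \<open>0 * \<infinity> = 0\<close> in the extended reals.\<close>

definition kl_weighted :: "nat \<Rightarrow> rmat \<Rightarrow> rmat \<Rightarrow> rmat \<Rightarrow> ereal" where
  "kl_weighted n B M M' =
     (\<Sum>(i, j)\<in>node_pairs n. ereal (B i j) * kl_bernoulli (M i j) (M' i j))"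

definition weighted_norm_sq :: "nat \<Rightarrow> rmat \<Rightarrow> rmat \<Rightarrow> real" where
  "weighted_norm_sq n B M = (\<Sum>(i, j)\<in>node_pairs n. B i j * (M i j)\<^sup>2)"

definition block_matrix :: "rmat \<Rightarrow> (nat \<Rightarrow> nat) \<Rightarrow> rmat" where
  "block_matrix Q z i j = (if i = j then 0 else Q (z i) (z j))"

text \<open>
  Minimisers need not be unique; the following predicates hold of every element of the
  respective argmin set.
\<close>

definition is_oracle ::
  "nat \<Rightarrow> nat \<Rightarrow> rmat \<Rightarrow> rmat \<Rightarrow> rmat \<times> (nat \<Rightarrow> nat) \<Rightarrow> bool" where
  "is_oracle n k P Theta =
     is_arg_min (\<lambda>(Q, z). kl_weighted n P Theta (\<lambda>i j. Q (z i) (z j)))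
       (\<lambda>Qz. Qz \<in> sym_mats k {0..1} \<times> labellings n k)"

definition is_restricted_mle ::
  "nat \<Rightarrow> nat \<Rightarrow> real \<Rightarrow> real \<Rightarrow> rmat \<Rightarrow> rmat \<Rightarrow> rmat \<times> (nat \<Rightarrow> nat) \<Rightarrow> bool" where
  "is_restricted_mle n k \<gamma> \<rho> A X =
     is_arg_min (\<lambda>(Q, z). kl_weighted n X A (\<lambda>i j. Q (z i) (z j)))
       (\<lambda>Qz. Qz \<in> sym_mats k {\<gamma>..\<rho>} \<times> labellings n k)"

end

theory Submission
  imports Defs
begin

text \<open>
  The restricted maximum likelihood estimator is compared with a competitor inside its own
  parameter set: the oracle with its entries clipped to \<open>[\<gamma>, \<rho>]\<close>. Clipping moves each entry
  towards all the connection probabilities, hence can only decrease the Kullback-Leibler risk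
  (\<open>kl_div_clip_le\<close>). Write \<open>L q\<close> for the observed log-likelihood ratio of the truth against \<open>q\<close>
  (\<open>log_loss\<close>); the estimator \<open>q\<close> and the competitor \<open>qc\<close> satisfy \<open>L q \<le> L qc\<close>, because the terms
  that depend only on the truth cancel. It then remains to bound \<open>L\<close> from above at the single
  point \<open>qc\<close>, and from below uniformly in \<open>q\<close>. Both follow from one exponential Markov inequality
  for sums over observed pairs (\<open>observed_edges_chernoff\<close>).

  Upper bound. All log-likelihood ratios are at most
  \<open>\<kappa> = \<rho>\<^sup>2 / min ((1 - \<rho>)\<^sup>2) (\<gamma>\<^sup>2)\<close>, and at scale \<open>1 / \<kappa>\<close> their exponential moment under the
  truth exceeds 1 by at most a multiple of the divergence itself (\<open>log_lik_ratio_mgf_le_kl\<close>). So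
  \<open>L qc \<le> 5 KL + \<kappa> s\<close> up to probability \<open>exp (- s)\<close>, without any condition number in front of the
  divergence.

  Lower bound. The exponential moment of \<open>- L q / 2\<close> is controlled exactly by the Hellinger
  risk (\<open>half_log_lik_ratio_mgf\<close>), and the Hellinger risk dominates the squared error up to a factor
  \<open>8 \<rho>\<close>. A naive union bound over a fine net of \<open>k \<times> k\<close> matrices would cost a factor \<open>ln n\<close> on
  \<open>k\<^sup>2\<close>. It is avoided as follows. For a fixed labelling, the parameter of each block runs through
  a grid that is equally spaced on the square root scale, with spacing \<open>1 / sqrt w\<close>, where \<open>w\<close> is
  the expected number of observed pairs of the block (or \<open>1 / \<rho>\<close> if that is larger). Half of the
  Hellinger risk is kept in reserve to make the union bound a Gaussian sum over this grid, which
  is bounded by an absolute constant per block (\<open>sqrt_grid_gaussian_sum\<close>, \<open>grid_lower_tail\<close>). The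
  total cost is thus a multiple of \<open>k\<^sup>2\<close>. Rounding a parameter to the grid costs little in
  likelihood: one may choose between the two neighbouring grid points, so the linear term can be
  given a favourable sign (\<open>log_lik_ratio_rounding\<close>), and the quadratic term adds up to a multiple of
  \<open>\<kappa> k\<^sup>2\<close> with high probability (\<open>rounding_cost_tail\<close>).

  A union bound over the \<open>k ^ n\<close> labellings adds \<open>n ln k\<close>, and the failure probability is at most
  \<open>3 exp (- n ln k)\<close> (\<open>restricted_mle_bound\<close>). Since \<open>\<rho> < 1\<close>, this is stronger than the stated
  probability with constant 1.
\<close>

section \<open>Sums over observed pairs\<close>

text \<open>
  The joint law of the edges and of the observation mask, indexed by an arbitrary set of pairs;
  outcomes are pairs \<open>(a, x)\<close> of edge indicators and observation indicators.
\<close>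

definition observed_edges :: "'e set \<Rightarrow> ('e \<Rightarrow> real) \<Rightarrow> ('e \<Rightarrow> real) \<Rightarrow> (('e \<Rightarrow> bool) \<times> ('e \<Rightarrow> bool)) pmf" where
  "observed_edges E \<theta> \<pi> =
     pair_pmf (Pi_pmf E False (\<lambda>e. bernoulli_pmf (\<theta> e))) (Pi_pmf E False (\<lambda>e. bernoulli_pmf (\<pi> e)))"

definition observed_sum :: "'e set \<Rightarrow> ('e \<Rightarrow> bool \<Rightarrow> real) \<Rightarrow> ('e \<Rightarrow> bool) \<times> ('e \<Rightarrow> bool) \<Rightarrow> real" where
  "observed_sum E \<phi> \<omega> = (\<Sum>e\<in>E. of_bool (snd \<omega> e) * \<phi> e (fst \<omega> e))"

definition log_lik_ratio :: "real \<Rightarrow> real \<Rightarrow> bool \<Rightarrow> real" where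
  "log_lik_ratio p q a = (if a then ln (p / q) else ln ((1 - p) / (1 - q)))"

text \<open>
  The real-valued form of the divergence, meaningful for parameters strictly between 0 and 1.
\<close>

definition kl_div :: "real \<Rightarrow> real \<Rightarrow> real" where
  "kl_div p q = p * ln (p / q) + (1 - p) * ln ((1 - p) / (1 - q))"

definition hellinger_sq :: "real \<Rightarrow> real \<Rightarrow> real" where
  "hellinger_sq p q = 1 - (sqrt (p * q) + sqrt ((1 - p) * (1 - q)))"

text \<open>
  Every tail bound below rests on this exponential Markov inequality. The exponential
  moment factorises over the pairs, and a pair contributes \<open>1 + \<pi> (m - 1) \<le> exp (\<pi> (m - 1))\<close>,
  where \<open>m\<close> is the exponential moment of \<open>\<phi>\<close> under the edge distribution alone.
\<close>

lemma observed_edges_chernoff: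
  assumes "finite E"
    and \<theta>: "\<And>e. e \<in> E \<Longrightarrow> \<theta> e \<in> {0..1}" and \<pi>: "\<And>e. e \<in> E \<Longrightarrow> \<pi> e \<in> {0..1}"
  shows "measure_pmf.prob (observed_edges E \<theta> \<pi>) {\<omega>. s \<le> observed_sum E \<phi> \<omega>}
    \<le> exp ((\<Sum>e\<in>E. \<pi> e * (\<theta> e * exp (\<phi> e True) + (1 - \<theta> e) * exp (\<phi> e False) - 1)) - s)"
proof -
  let ?M = "observed_edges E \<theta> \<pi>"
  let ?A = "Pi_pmf E False (\<lambda>e. bernoulli_pmf (\<theta> e))" and ?X = "Pi_pmf E False (\<lambda>e. bernoulli_pmf (\<pi> e))"
  define m where "m e = \<theta> e * exp (\<phi> e True) + (1 - \<theta> e) * exp (\<phi> e False)" for e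
  have m0: "0 \<le> m e" if "e \<in> E" for e
    using \<theta>[OF that] by (auto simp: m_def)
  have coord: "(\<integral>\<^sup>+a. \<integral>\<^sup>+x. ennreal (exp (of_bool x * \<phi> e a)) \<partial>bernoulli_pmf (\<pi> e) \<partial>bernoulli_pmf (\<theta> e))
      = ennreal (1 + \<pi> e * (m e - 1))" if "e \<in> E" for e
  proof -
    have r: "0 \<le> \<theta> e" "\<theta> e \<le> 1" "0 \<le> \<pi> e" "\<pi> e \<le> 1" using \<theta>[OF that] \<pi>[OF that] by auto
    have "ennreal (exp (\<phi> e a)) * ennreal (\<pi> e) + ennreal 1 * ennreal (1 - \<pi> e)
        = ennreal (exp (\<phi> e a) * \<pi> e + (1 - \<pi> e))" for a
      using r by (simp add: ennreal_mult'[symmetric] ennreal_plus[symmetric] del: ennreal_plus)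
    hence "(\<integral>\<^sup>+a. \<integral>\<^sup>+x. ennreal (exp (of_bool x * \<phi> e a)) \<partial>bernoulli_pmf (\<pi> e) \<partial>bernoulli_pmf (\<theta> e))
      = (\<integral>\<^sup>+a. ennreal (exp (\<phi> e a) * \<pi> e + (1 - \<pi> e)) \<partial>bernoulli_pmf (\<theta> e))"
      using r by simp
    also have "\<dots> = ennreal ((exp (\<phi> e True) * \<pi> e + (1 - \<pi> e)) * \<theta> e + (exp (\<phi> e False) * \<pi> e + (1 - \<pi> e)) * (1 - \<theta> e))"
      using r by (simp add: ennreal_mult'[symmetric] ennreal_plus[symmetric] del: ennreal_plus)
    also have "(exp (\<phi> e True) * \<pi> e + (1 - \<pi> e)) * \<theta> e + (exp (\<phi> e False) * \<pi> e + (1 - \<pi> e)) * (1 - \<theta> e)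
      = 1 + \<pi> e * (m e - 1)"
      by (simp add: m_def algebra_simps)
    finally show ?thesis .
  qed
  have "(\<integral>\<^sup>+\<omega>. ennreal (exp (observed_sum E \<phi> \<omega>)) \<partial>?M)
      = (\<integral>\<^sup>+a. \<integral>\<^sup>+x. (\<Prod>e\<in>E. ennreal (exp (of_bool (x e) * \<phi> e (a e)))) \<partial>?X \<partial>?A)"
    unfolding observed_edges_def nn_integral_pair_pmf' observed_sum_def exp_sum[OF assms(1)] fst_conv snd_conv
    by (subst prod_ennreal) (rule exp_ge_zero refl)+
  also have "\<dots> = (\<integral>\<^sup>+a. (\<Prod>e\<in>E. \<integral>\<^sup>+x. ennreal (exp (of_bool x * \<phi> e (a e))) \<partial>bernoulli_pmf (\<pi> e)) \<partial>?A)"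
    using nn_integral_prod_Pi_pmf[OF assms(1), of False "\<lambda>e. bernoulli_pmf (\<pi> e)"
        "\<lambda>e x. ennreal (exp (of_bool x * \<phi> e (a e)))" for a] by simp
  also have "\<dots> = (\<Prod>e\<in>E. \<integral>\<^sup>+a. \<integral>\<^sup>+x. ennreal (exp (of_bool x * \<phi> e a)) \<partial>bernoulli_pmf (\<pi> e) \<partial>bernoulli_pmf (\<theta> e))"
    by (rule nn_integral_prod_Pi_pmf[OF assms(1), of False "\<lambda>e. bernoulli_pmf (\<theta> e)"
        "\<lambda>e a. \<integral>\<^sup>+x. ennreal (exp (of_bool x * \<phi> e a)) \<partial>bernoulli_pmf (\<pi> e)"])
  also have "\<dots> = (\<Prod>e\<in>E. ennreal (1 + \<pi> e * (m e - 1)))"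
    by (intro prod.cong refl coord)
  also have "\<dots> \<le> (\<Prod>e\<in>E. ennreal (exp (\<pi> e * (m e - 1))))"
    by (intro prod_mono_ennreal ennreal_leI exp_ge_add_one_self)
  also have "\<dots> = ennreal (exp (\<Sum>e\<in>E. \<pi> e * (m e - 1)))"
    by (simp add: exp_sum assms(1) prod_ennreal)
  finally have mgf: "(\<integral>\<^sup>+\<omega>. ennreal (exp (observed_sum E \<phi> \<omega>)) \<partial>?M) \<le> ennreal (exp (\<Sum>e\<in>E. \<pi> e * (m e - 1)))" .
  have "emeasure ?M {\<omega>. s \<le> observed_sum E \<phi> \<omega>}
     \<le> ennreal (exp (- s)) * (\<integral>\<^sup>+\<omega>. ennreal (exp (observed_sum E \<phi> \<omega>)) \<partial>?M)"
    using Chernoff_ineq_nn_integral_ge[of 1 UNIV "measure_pmf ?M" "observed_sum E \<phi>" s] by simp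
  also have "\<dots> \<le> ennreal (exp (- s)) * ennreal (exp (\<Sum>e\<in>E. \<pi> e * (m e - 1)))"
    by (intro mult_left_mono mgf) auto
  also have "\<dots> = ennreal (exp ((\<Sum>e\<in>E. \<pi> e * (m e - 1)) - s))"
    by (simp add: ennreal_mult'[symmetric] exp_add[symmetric])
  finally show ?thesis
    by (simp add: measure_pmf.emeasure_eq_measure m_def)
qed

section \<open>Hellinger and Kullback-Leibler bounds for one Bernoulli variable\<close>

text \<open>
  At exponent one half the moment is the Bhattacharyya affinity, so no bound on the
  log-likelihood ratio is involved.
\<close>

lemma half_log_lik_ratio_mgf:
  assumes "0 < p" "p < 1" "0 < q" "q < 1"
  shows "p * exp (- log_lik_ratio p q True / 2) + (1 - p) * exp (- log_lik_ratio p q False / 2) - 1 = - hellinger_sq p q"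
proof -
  have *: "x * exp (- ln (x / y) / 2) = sqrt (x * y)" if "0 < x" "0 < y" for x y :: real
  proof -
    have "exp (- ln (x / y) / 2) = sqrt (y / x)"
      using that by (simp add: ln_div powr_half_sqrt[symmetric] powr_def)
    hence "x * exp (- ln (x / y) / 2) = (sqrt x * sqrt x) * (sqrt y / sqrt x)"
      using that by (simp add: real_sqrt_divide)
    also have "\<dots> = sqrt x * sqrt y" using that by (simp del: real_sqrt_mult_self)
    finally show ?thesis by (simp add: real_sqrt_mult)
  qed
  show ?thesis using assms *[of p q] *[of "1-p" "1-q"]
    by (simp add: log_lik_ratio_def hellinger_sq_def)
qed

text \<open>
  Together with the next lemma this turns Hellinger distance into squared error; the upper bound
  \<open>\<rho>\<close> on both parameters produces the factor \<open>\<rho>\<close> of the final risk bound.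
\<close>

lemma hellinger_sq_ge:
  assumes "0 \<le> p" "p \<le> 1" "0 \<le> q" "q \<le> 1"
  shows "(sqrt p - sqrt q)\<^sup>2 \<le> 2 * hellinger_sq p q"
proof -
  have "(sqrt p - sqrt q)\<^sup>2 + (sqrt (1 - p) - sqrt (1 - q))\<^sup>2 = 2 * hellinger_sq p q"
    using assms by (simp add: hellinger_sq_def power2_diff real_sqrt_mult)
  thus ?thesis by (smt (verit) zero_le_power2)
qed

lemma diff_sq_le_sqrt:
  assumes "0 \<le> p" "p \<le> \<rho>" "0 \<le> q" "q \<le> (\<rho>::real)"
  shows "(p - q)\<^sup>2 \<le> 4 * \<rho> * (sqrt p - sqrt q)\<^sup>2"
proof -
  have "(p - q)\<^sup>2 = (sqrt p + sqrt q)\<^sup>2 * (sqrt p - sqrt q)\<^sup>2"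
  proof -
    have "p - q = (sqrt p + sqrt q) * (sqrt p - sqrt q)"
      using assms by (simp add: square_diff_square_factored[symmetric] power2_eq_square[symmetric])
    thus ?thesis by (simp add: power_mult_distrib)
  qed
  also have "(sqrt p + sqrt q)\<^sup>2 \<le> 4 * \<rho>"
  proof -
    have "(sqrt p + sqrt q)\<^sup>2 \<le> (sqrt \<rho> + sqrt \<rho>)\<^sup>2"
      using assms by (intro power_mono add_mono) auto
    thus ?thesis using assms by (simp add: power2_sum power2_eq_square)
  qed
  finally show ?thesis by (simp add: mult_right_mono)
qed

text \<open>
  The bracket \<open>exp (- y) - 1 + y\<close> is nonnegative, and its expectation under \<open>p\<close>, for the
  log-likelihood ratio \<open>y\<close> of \<open>p\<close> against \<open>q\<close>, is the divergence of \<open>p\<close> from \<open>q\<close>. It is quadratic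
  for small \<open>y\<close> and linear for large positive \<open>y\<close>, which is why the scale \<open>l\<close> must satisfy
  \<open>l * y \<le> 1\<close>.
\<close>

lemma exp_scaled_le:
  fixes y l :: real
  assumes "0 < l" "l \<le> 1" "l * y \<le> 1"
  shows "exp (l * y) \<le> 1 + l * y + 4 * l * (exp (- y) - 1 + y)"
proof (cases "0 \<le> y")
  case True
  \<comment> \<open>This says \<open>1 - y\<^sup>2 / 2 \<le> (1 + y) * exp (- y)\<close>, with equality at 0.\<close>
  have mono: "(1 + 0) * exp (- 0) + 0\<^sup>2 / 2 \<le> (1 + y) * exp (- y) + y\<^sup>2 / (2::real)"
  proof (rule DERIV_nonneg_imp_nondecreasing[OF True])
    fix x :: real assume "0 \<le> x" "x \<le> y"
    have "((\<lambda>x. (1 + x) * exp (- x) + x\<^sup>2 / 2) has_real_derivative x * (1 - exp (- x))) (at x)"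
      by (auto intro!: derivative_eq_intros simp: algebra_simps)
    moreover have "0 \<le> x * (1 - exp (- x))"
      using \<open>0 \<le> x\<close> by (intro mult_nonneg_nonneg) auto
    ultimately show "\<exists>D. ((\<lambda>x. (1 + x) * exp (- x) + x\<^sup>2 / 2) has_real_derivative D) (at x) \<and> 0 \<le> D"
      by blast
  qed
  have "0 \<le> exp (- y) - 1 + y" using exp_ge_add_one_self[of "- y"] by linarith
  have "2 * y\<^sup>2 \<le> 4 * (1 + y) * (exp (- y) - 1 + y)"
    using mono by (simp add: algebra_simps power2_eq_square)
  \<comment> \<open>Both \<open>l \<le> 1\<close> and \<open>l * y \<le> 1\<close> enter here, through \<open>l * (1 + y) \<le> 2\<close>.\<close>
  moreover have "l * (1 + y) * y\<^sup>2 \<le> 2 * y\<^sup>2"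
    using assms True by (intro mult_right_mono) (auto simp: algebra_simps)
  ultimately have "(1 + y) * (l * y\<^sup>2) \<le> (1 + y) * (4 * (exp (- y) - 1 + y))"
    by (simp add: algebra_simps)
  hence "l * y\<^sup>2 \<le> 4 * (exp (- y) - 1 + y)"
    using True by (subst (asm) mult_le_cancel_left_pos) auto
  hence "l * (l * y\<^sup>2) \<le> l * (4 * (exp (- y) - 1 + y))"
    using assms by (intro mult_left_mono) auto
  moreover have "exp (l * y) \<le> 1 + l * y + (l * y)\<^sup>2"
    using assms True by (intro exp_bound) auto
  ultimately show ?thesis by (simp add: power2_eq_square algebra_simps)
next
  case False
  define u where "u = - y"
  have "0 < u" using False by (simp add: u_def)
  hence u: "0 < u" "0 < l * u" using assms by simp_all
  \<comment> \<open>This yields \<open>exp (- v) \<le> 1 - v + v\<^sup>2\<close> for \<open>v = l * u\<close>, as the second factor is below \<open>exp v\<close>.\<close>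
  have "1 \<le> (1 - l * u + (l * u)\<^sup>2) * (1 + l * u + (l * u)\<^sup>2 / 2)"
  proof -
    have "(1 - l * u + (l * u)\<^sup>2) * (1 + l * u + (l * u)\<^sup>2 / 2)
      = 1 + (l * u)\<^sup>2 / 2 + (l * u) ^ 3 / 2 + (l * u) ^ 4 / 2"
      by (simp add: power2_eq_square power3_eq_cube power4_eq_xxxx field_simps)
    thus ?thesis using u by simp
  qed
  also have "\<dots> \<le> (1 - l * u + (l * u)\<^sup>2) * exp (l * u)"
  proof (intro mult_left_mono exp_lower_Taylor_quadratic)
    have "(1 - l * u + (l * u)\<^sup>2) = (l * u - 1/2)\<^sup>2 + 3/4" by (simp add: power2_eq_square algebra_simps)
    thus "0 \<le> 1 - l * u + (l * u)\<^sup>2" by simp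
  qed (use u in auto)
  finally have "exp (l * y) \<le> 1 - l * u + (l * u)\<^sup>2"
    by (simp add: u_def exp_minus field_simps)
  moreover have "(l * u)\<^sup>2 \<le> l * u\<^sup>2"
  proof -
    have "l * (l * u\<^sup>2) \<le> l * (1 * u\<^sup>2)"
      using assms by (intro mult_left_mono mult_right_mono) auto
    thus ?thesis by (simp add: power2_eq_square mult_ac)
  qed
  moreover have "l * (1 + u + u\<^sup>2 / 2) \<le> l * exp u"
    using assms u by (intro mult_left_mono exp_lower_Taylor_quadratic) auto
  moreover have "0 \<le> l * u\<^sup>2" using assms by simp
  ultimately show ?thesis by (simp add: u_def algebra_simps)
qed

lemma log_lik_ratio_mgf_le_kl:
  assumes "0 < p" "p < 1" "0 < q" "q < 1" "0 < l" "l \<le> 1"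
    and "l * log_lik_ratio p q True \<le> 1" "l * log_lik_ratio p q False \<le> 1"
  shows "p * exp (l * log_lik_ratio p q True) + (1 - p) * exp (l * log_lik_ratio p q False) - 1 \<le> 5 * l * kl_div p q"
proof -
  have e: "p * exp (- log_lik_ratio p q True) = q" "(1-p) * exp (- log_lik_ratio p q False) = (1-q)"
    using assms by (simp_all add: log_lik_ratio_def exp_minus)
  have "p * exp (l * log_lik_ratio p q True) \<le> p * (1 + l * log_lik_ratio p q True + 4 * l * (exp (- log_lik_ratio p q True) - 1 + log_lik_ratio p q True))"
    using assms by (intro mult_left_mono exp_scaled_le) auto
  also have "\<dots> = p + 5 * l * (p * log_lik_ratio p q True) + 4 * l * (p * exp (- log_lik_ratio p q True) - p)"
    by (simp add: algebra_simps)
  also note e(1)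
  finally have 1: "p * exp (l * log_lik_ratio p q True) \<le> p + 5 * l * (p * log_lik_ratio p q True) + 4 * l * (q - p)" .
  have "(1-p) * exp (l * log_lik_ratio p q False) \<le> (1-p) * (1 + l * log_lik_ratio p q False + 4 * l * (exp (- log_lik_ratio p q False) - 1 + log_lik_ratio p q False))"
    using assms by (intro mult_left_mono exp_scaled_le) auto
  also have "\<dots> = (1-p) + 5 * l * ((1-p) * log_lik_ratio p q False) + 4 * l * ((1-p) * exp (- log_lik_ratio p q False) - (1-p))"
    by (simp add: algebra_simps)
  also note e(2)
  finally have 2: "(1-p) * exp (l * log_lik_ratio p q False) \<le> (1-p) + 5 * l * ((1-p) * log_lik_ratio p q False) + 4 * l * ((1-q) - (1-p))" .
  have k: "kl_div p q = p * log_lik_ratio p q True + (1-p) * log_lik_ratio p q False"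
    by (simp add: kl_div_def log_lik_ratio_def)
  show ?thesis using 1 2 unfolding k by (simp add: algebra_simps)
qed

text \<open>
  Moving a parameter \<open>q\<close> to a nearby \<open>g\<close> changes the log-likelihood of \<open>S\<close> successes and \<open>T\<close>
  failures by a term linear in \<open>q - g\<close> and a quadratic remainder. The linear terms at points on
  either side of \<open>q\<close> have opposite signs, so one of the two sides costs only the remainder.
\<close>

lemma log_lik_ratio_rounding:
  assumes "0 < \<gamma>" "\<gamma> \<le> g1" "g1 \<le> q" "q \<le> g2" "g2 \<le> \<rho>" "\<rho> < 1" "0 \<le> S" "0 \<le> T"
    and d: "(g1 - q)\<^sup>2 \<le> d" "(g2 - q)\<^sup>2 \<le> d"
  shows "\<exists>g\<in>{g1, g2}. S * log_lik_ratio q g True + T * log_lik_ratio q g False \<le> d * (S / \<gamma>\<^sup>2 + T / (1 - \<rho>)\<^sup>2)"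
proof -
  define c where "c = S / q - T / (1 - q)"
  \<comment> \<open>From \<open>ln t \<le> t - 1\<close>, expanding \<open>x / y - 1\<close> around \<open>y = x\<close>.\<close>
  have lnb: "ln (x / y) \<le> (x - y) / x + d / z\<^sup>2"
    if "0 < z" "z \<le> x" "z \<le> y" "(y - x)\<^sup>2 \<le> d" for x y z :: real
  proof -
    have pos: "0 < x" "0 < y" using that by auto
    have "ln (x / y) \<le> x / y - 1" using pos by (intro ln_le_minus_one) auto
    also have "\<dots> = (x - y) / x + (y - x)\<^sup>2 / (x * y)"
      using pos by (simp add: field_simps power2_eq_square)
    also have "(y - x)\<^sup>2 / (x * y) \<le> d / z\<^sup>2"
      unfolding power2_eq_square[of z] using that pos
      by (intro frac_le mult_mono) (auto intro: order_trans[OF zero_le_power2])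
    finally show ?thesis by simp
  qed
  have key: "S * log_lik_ratio q g True + T * log_lik_ratio q g False \<le> (q - g) * c + d * (S / \<gamma>\<^sup>2 + T / (1 - \<rho>)\<^sup>2)"
    if "\<gamma> \<le> g" "g \<le> \<rho>" "(g - q)\<^sup>2 \<le> d" for g
  proof -
    have "S * log_lik_ratio q g True \<le> S * ((q - g) / q + d / \<gamma>\<^sup>2)"
      unfolding log_lik_ratio_def using assms that by (simp, intro mult_left_mono lnb) auto
    moreover have "((1 - g) - (1 - q))\<^sup>2 \<le> d" using that by (simp add: power2_commute)
    hence "T * log_lik_ratio q g False \<le> T * (((1 - q) - (1 - g)) / (1 - q) + d / (1 - \<rho>)\<^sup>2)"
      unfolding log_lik_ratio_def using assms that by (simp only: if_False, intro mult_left_mono lnb) auto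
    moreover have "S * ((q - g) / q + d / \<gamma>\<^sup>2) + T * (((1 - q) - (1 - g)) / (1 - q) + d / (1 - \<rho>)\<^sup>2)
       = (q - g) * c + d * (S / \<gamma>\<^sup>2 + T / (1 - \<rho>)\<^sup>2)"
    proof -
      have "((1 - q) - (1 - g)) / (1 - q) = - ((q - g) / (1 - q))"
        by (simp add: minus_divide_left)
      thus ?thesis by (simp add: c_def algebra_simps)
    qed
    ultimately show ?thesis by linarith
  qed
  show ?thesis
  proof (cases "c \<le> 0")
    case True
    have "(q - g1) * c \<le> 0" using True assms by (simp add: mult_nonneg_nonpos)
    thus ?thesis using key[of g1] assms by force
  next
    case False
    have "(q - g2) * c \<le> 0" using False assms by (simp add: mult_nonpos_nonneg)
    thus ?thesis using key[of g2] assms by force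
  qed
qed

section \<open>A grid on the square root scale\<close>

text \<open>
  A Gaussian sum over integers is bounded uniformly in its centre: each integer part of the
  distance to the centre occurs at most once on either side, and the summands decay at least
  geometrically in that integer part.
\<close>

lemma sum_exp_quadratic_le:
  fixes c :: real
  assumes "finite J"
  shows "(\<Sum>j\<in>J. exp (- (real j - c)\<^sup>2 / 4)) \<le> 12"
proof -
  define f where "f j = nat \<lfloor>\<bar>real j - c\<bar>\<rfloor>" for j
  have bound: "exp (- (real j - c)\<^sup>2 / 4) \<le> 3 * (1 / 2) ^ f j" for j
  proof -
    define x where "x = \<bar>real j - c\<bar>"
    have "real (f j) \<le> x" by (simp add: f_def x_def)
    moreover have "x \<le> 1 + x\<^sup>2 / 4"
      using zero_le_power2[of "x / 2 - 1"] by (simp add: power2_eq_square algebra_simps)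
    ultimately have "- (real j - c)\<^sup>2 / 4 \<le> 1 + real (f j) * (- 1)"
      by (simp add: x_def)
    hence "exp (- (real j - c)\<^sup>2 / 4) \<le> exp 1 * exp (real (f j) * (- 1))"
      by (subst exp_add[symmetric], subst exp_le_cancel_iff)
    also have "exp (real (f j) * (- 1)) = exp (- 1 :: real) ^ f j"
      by (rule exp_of_nat_mult)
    also have "exp 1 * exp (- 1 :: real) ^ f j \<le> 3 * (1 / 2) ^ f j"
    proof (intro mult_mono power_mono exp_le)
      have "2 \<le> exp (1::real)" using exp_ge_add_one_self[of 1] by simp
      thus "exp (- 1 :: real) \<le> 1 / 2" by (simp add: exp_minus field_simps)
    qed auto
    finally show ?thesis .
  qed
  have half: "(\<Sum>j\<in>I. 3 * (1 / 2 :: real) ^ f j) \<le> 6" if "finite I" "inj_on f I" for I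
  proof -
    have "(\<Sum>j\<in>I. (1 / 2 :: real) ^ f j) = (\<Sum>i\<in>f ` I. (1 / 2) ^ i)"
      using that by (simp add: sum.reindex)
    also have "\<dots> \<le> (\<Sum>i. (1 / 2) ^ i)"
      using that by (intro sum_le_suminf) auto
    also have "\<dots> = 2" by (simp add: suminf_geometric)
    finally show ?thesis by (simp add: sum_distrib_left[symmetric])
  qed
  have "inj_on f {j \<in> J. c \<le> real j}"
    by (rule inj_onI) (simp add: f_def, linarith)
  moreover have "inj_on f {j \<in> J. \<not> c \<le> real j}"
    by (rule inj_onI) (simp add: f_def, linarith)
  ultimately have "(\<Sum>j\<in>{j \<in> J. c \<le> real j}. 3 * (1 / 2 :: real) ^ f j)
      + (\<Sum>j\<in>{j \<in> J. \<not> c \<le> real j}. 3 * (1 / 2 :: real) ^ f j) \<le> 6 + 6"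
    using assms by (intro add_mono half) auto
  also have "(\<Sum>j\<in>{j \<in> J. c \<le> real j}. 3 * (1 / 2 :: real) ^ f j)
      + (\<Sum>j\<in>{j \<in> J. \<not> c \<le> real j}. 3 * (1 / 2 :: real) ^ f j) = (\<Sum>j\<in>J. 3 * (1 / 2) ^ f j)"
    using assms by (subst sum.union_disjoint[symmetric]) (auto intro!: sum.cong)
  finally show ?thesis
    using sum_mono[OF bound, of "\<lambda>j. j" J] by linarith
qed

text \<open>
  The endpoints are included so that every point of \<open>[\<gamma>, \<rho>]\<close> lies between two grid points. On the
  square root scale the Hellinger distance is essentially Euclidean, so a uniform spacing there
  adapts to the variance of the Bernoulli variables.
\<close>

definition sqrt_grid :: "real \<Rightarrow> real \<Rightarrow> real \<Rightarrow> real set" where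
  "sqrt_grid \<gamma> \<rho> w = {\<gamma>, \<rho>} \<union> (\<lambda>j. (real j / sqrt w)\<^sup>2) ` {j. real j \<le> sqrt (\<rho> * w)} \<inter> {\<gamma>..\<rho>}"

lemma finite_nat_real_le: "finite {j. real j \<le> x}"
  by (rule finite_subset[of _ "{..nat \<lfloor>x\<rfloor>}"]) (auto simp: le_nat_floor)

lemma finite_sqrt_grid: "finite (sqrt_grid \<gamma> \<rho> w)"
  by (simp add: sqrt_grid_def finite_nat_real_le)

lemma sqrt_grid_subset: "\<gamma> \<le> \<rho> \<Longrightarrow> sqrt_grid \<gamma> \<rho> w \<subseteq> {\<gamma>..\<rho>}"
  by (auto simp: sqrt_grid_def)

lemma sqrt_grid_neighbours:
  assumes "0 < \<gamma>" "\<gamma> \<le> q" "q \<le> \<rho>" "0 < w"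
  shows "\<exists>g1\<in>sqrt_grid \<gamma> \<rho> w. \<exists>g2\<in>sqrt_grid \<gamma> \<rho> w. g1 \<le> q \<and> q \<le> g2 \<and>
    (g1 - q)\<^sup>2 \<le> 4 * \<rho> / w \<and> (g2 - q)\<^sup>2 \<le> 4 * \<rho> / w"
proof -
  define j where "j = nat \<lfloor>sqrt (q * w)\<rfloor>"
  \<comment> \<open>The squares \<open>a\<close> and \<open>b\<close> of consecutive grid values enclose \<open>q\<close>; the neighbours in
      the grid are \<open>max \<gamma> a\<close> and \<open>min \<rho> b\<close>.\<close>
  define a where "a = (real j / sqrt w)\<^sup>2"
  define b where "b = (real (Suc j) / sqrt w)\<^sup>2"
  have q: "0 < q" and sw: "0 < sqrt w" using assms by auto
  have "0 \<le> sqrt (q * w)" using q assms by simp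
  hence j: "real j \<le> sqrt (q * w)" "sqrt (q * w) < real (Suc j)"
    unfolding j_def by linarith+
  have sqa: "sqrt a = real j / sqrt w" "sqrt b = real (Suc j) / sqrt w"
    using sw by (simp_all add: a_def b_def del: of_nat_Suc)
  have ab: "sqrt a \<le> sqrt q" "sqrt q \<le> sqrt b" "sqrt b - sqrt a = 1 / sqrt w"
    using j sw unfolding sqa by (simp_all add: real_sqrt_mult field_simps)
  have aq: "a \<le> q" "q \<le> b" using ab by simp_all
  have close: "(g - q)\<^sup>2 \<le> 4 * \<rho> / w" if "\<gamma> \<le> g" "g \<le> \<rho>" "a \<le> g" "g \<le> b" for g
  proof -
    have "sqrt a \<le> sqrt g" "sqrt g \<le> sqrt b" using that by auto
    hence "\<bar>sqrt g - sqrt q\<bar> \<le> 1 / sqrt w" using ab by linarith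
    hence "\<bar>sqrt g - sqrt q\<bar>\<^sup>2 \<le> (1 / sqrt w)\<^sup>2" by (intro power_mono) auto
    hence "(sqrt g - sqrt q)\<^sup>2 \<le> 1 / w" using assms by (simp add: power_divide)
    hence "4 * \<rho> * (sqrt g - sqrt q)\<^sup>2 \<le> 4 * \<rho> * (1 / w)"
      using assms by (intro mult_left_mono) auto
    moreover have "(g - q)\<^sup>2 \<le> 4 * \<rho> * (sqrt g - sqrt q)\<^sup>2"
      using assms that by (intro diff_sq_le_sqrt) auto
    ultimately show ?thesis by simp
  qed
  have "sqrt (q * w) \<le> sqrt (\<rho> * w)" using assms by simp
  hence "max \<gamma> a \<in> sqrt_grid \<gamma> \<rho> w"
    using order_trans[OF j(1)] aq assms
    by (auto simp: sqrt_grid_def max_def a_def intro!: image_eqI[of _ _ j])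
  moreover have "min \<rho> b \<in> sqrt_grid \<gamma> \<rho> w"
  proof (cases "b \<le> \<rho>")
    case True
    hence "real (Suc j) / sqrt w \<le> sqrt \<rho>" using sqa(2) by (metis real_sqrt_le_iff)
    hence "real (Suc j) \<le> sqrt (\<rho> * w)" using sw by (simp add: real_sqrt_mult field_simps)
    thus ?thesis using True aq assms unfolding sqrt_grid_def
      by (auto simp: min_def b_def intro!: image_eqI[of _ _ "Suc j"])
  qed (auto simp: sqrt_grid_def min_def)
  moreover have "(max \<gamma> a - q)\<^sup>2 \<le> 4 * \<rho> / w" "(min \<rho> b - q)\<^sup>2 \<le> 4 * \<rho> / w"
    using aq assms by (intro close; simp)+
  ultimately show ?thesis using aq assms by (intro bexI[of _ "max \<gamma> a"] bexI[of _ "min \<rho> b"]) auto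
qed

text \<open>
  If \<open>W \<ge> 1 / \<rho>\<close>, the exponents are those of a Gaussian sum over integers. Otherwise the spacing
  is \<open>sqrt \<rho>\<close> and the grid has at most four points. The bound \<open>exp 3\<close> is a convenient number above
  \<open>2 + 12\<close>, the contributions of the endpoints and of the Gaussian sum.
\<close>

lemma sqrt_grid_gaussian_sum:
  assumes "0 < \<gamma>" "\<gamma> \<le> \<rho>" "0 \<le> W" and w: "w = max W (1 / \<rho>)"
  shows "(\<Sum>g\<in>sqrt_grid \<gamma> \<rho> w. exp (- (W * (sqrt g - m)\<^sup>2) / 4)) \<le> exp 3"
proof -
  define h where "h g = exp (- (W * (sqrt g - m)\<^sup>2) / 4)" for g
  define J where "J = {j. real j \<le> sqrt (\<rho> * w)}"
  have J: "finite J" by (simp add: J_def finite_nat_real_le)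
  have h: "0 \<le> h g" "h g \<le> 1" for g
    using assms by (auto simp: h_def)
  have rho: "0 < \<rho>" using assms by simp
  hence w0: "0 < w" by (simp add: w less_max_iff_disj)
  have grid: "(\<Sum>j\<in>J. h ((real j / sqrt w)\<^sup>2)) \<le> 12"
  proof (cases "1 / \<rho> \<le> W")
    case True
    hence wW: "w = W" by (simp add: w max_def)
    have "h ((real j / sqrt w)\<^sup>2) = exp (- (real j - m * sqrt w)\<^sup>2 / 4)" for j
    proof -
      have "real j - m * sqrt w = sqrt w * (real j / sqrt w - m)"
        using w0 by (simp add: field_simps)
      hence "(real j - m * sqrt w)\<^sup>2 = w * (real j / sqrt w - m)\<^sup>2"
        using w0 by (simp add: power_mult_distrib)
      thus ?thesis using w0 by (simp add: h_def wW)
    qed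
    thus ?thesis using sum_exp_quadratic_le[OF J, of "m * sqrt w"] by simp
  next
    case False
    hence "w = 1 / \<rho>" by (simp add: w)
    hence "J = {..1}" using rho by (auto simp: J_def)
    hence "(\<Sum>j\<in>J. h ((real j / sqrt w)\<^sup>2)) \<le> (\<Sum>j\<in>{..1::nat}. 1)"
      using h by (simp only:) (intro sum_mono)
    thus ?thesis by simp
  qed
  have "(\<Sum>g\<in>sqrt_grid \<gamma> \<rho> w. h g)
      \<le> (\<Sum>g\<in>{\<gamma>, \<rho>} \<union> (\<lambda>j. (real j / sqrt w)\<^sup>2) ` J. h g)"
    using J h by (intro sum_mono2) (auto simp: sqrt_grid_def J_def)
  also have "\<dots> \<le> (\<Sum>g\<in>{\<gamma>, \<rho>}. h g) + (\<Sum>g\<in>(\<lambda>j. (real j / sqrt w)\<^sup>2) ` J. h g)"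
    using J h by (subst sum_Un) (auto intro!: sum_nonneg)
  also have "(\<Sum>g\<in>{\<gamma>, \<rho>}. h g) \<le> (\<Sum>g\<in>{\<gamma>, \<rho>}. 1)" by (intro sum_mono h)
  also have "(\<Sum>g\<in>{\<gamma>, \<rho>}. 1::real) \<le> 2" by (simp add: card_insert_if)
  also have "(\<Sum>g\<in>(\<lambda>j. (real j / sqrt w)\<^sup>2) ` J. h g) \<le> (\<Sum>j\<in>J. h ((real j / sqrt w)\<^sup>2))"
    using J h by (intro sum_image_le[unfolded o_def]) auto
  also note grid
  also have "(2::real) + 12 \<le> (5 / 2) ^ 3" by (simp add: power3_eq_cube)
  also have "\<dots> \<le> exp 1 ^ 3"
    using exp_lower_Taylor_quadratic[of 1] by (intro power_mono) auto
  also have "\<dots> = exp (3::real)" by (simp add: exp_of_nat_mult[symmetric])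
  finally show ?thesis by (simp add: h_def)
qed

text \<open>
  Within a block the true parameters need not be equal, so the Hellinger risk of a constant \<open>g\<close>
  does not vanish anywhere. It still grows quadratically away from a centre: the bias-variance
  decomposition around the weighted mean \<open>m\<close> of the square roots leaves the squared distance from
  \<open>m\<close>, and the variance part is dropped.
\<close>

lemma block_hellinger_ge:
  assumes "finite D" and \<theta>: "\<And>e. e \<in> D \<Longrightarrow> \<theta> e \<in> {0..1}" and \<pi>: "\<And>e. e \<in> D \<Longrightarrow> 0 \<le> \<pi> e"
  shows "\<exists>m. \<forall>g\<in>{0..1}. sum \<pi> D * (sqrt g - m)\<^sup>2 \<le> 2 * (\<Sum>e\<in>D. \<pi> e * hellinger_sq (\<theta> e) g)"
proof -
  define W where "W = sum \<pi> D"
  define m where "m = (\<Sum>e\<in>D. \<pi> e * sqrt (\<theta> e)) / W"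
  have W0: "0 \<le> W" unfolding W_def by (intro sum_nonneg \<pi>)
  have Wm: "W * m = (\<Sum>e\<in>D. \<pi> e * sqrt (\<theta> e))"
  proof (cases "W = 0")
    case True
    hence "\<forall>e\<in>D. \<pi> e = 0" using sum_nonneg_eq_0_iff[OF assms(1) \<pi>] by (simp add: W_def)
    thus ?thesis using True by simp
  qed (simp add: m_def)
  show ?thesis
  proof (intro exI[of _ m] ballI)
    fix g :: real assume g: "g \<in> {0..1}"
    have "(\<Sum>e\<in>D. \<pi> e * (sqrt (\<theta> e) - sqrt g)\<^sup>2)
       = (\<Sum>e\<in>D. \<pi> e * (sqrt (\<theta> e) - m)\<^sup>2 + (m - sqrt g)\<^sup>2 * \<pi> e
              + 2 * (m - sqrt g) * (\<pi> e * sqrt (\<theta> e)) - 2 * (m - sqrt g) * m * \<pi> e)"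
      by (intro sum.cong) (auto simp: power2_eq_square algebra_simps)
    also have "\<dots> = (\<Sum>e\<in>D. \<pi> e * (sqrt (\<theta> e) - m)\<^sup>2) + (m - sqrt g)\<^sup>2 * W
              + 2 * (m - sqrt g) * (W * m) - 2 * (m - sqrt g) * m * W"
      by (subst Wm) (simp only: W_def sum.distrib sum_subtractf sum_distrib_left[symmetric])
    also have "\<dots> = (\<Sum>e\<in>D. \<pi> e * (sqrt (\<theta> e) - m)\<^sup>2) + (m - sqrt g)\<^sup>2 * W"
      by (simp add: algebra_simps)
    finally have "W * (sqrt g - m)\<^sup>2 \<le> (\<Sum>e\<in>D. \<pi> e * (sqrt (\<theta> e) - sqrt g)\<^sup>2)"
      using \<pi> by (simp add: sum_nonneg power2_commute mult.commute)
    also have "\<dots> \<le> (\<Sum>e\<in>D. \<pi> e * (2 * hellinger_sq (\<theta> e) g))"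
      using g \<theta> \<pi> by (intro sum_mono mult_left_mono hellinger_sq_ge) (auto simp: Ball_def)
    finally show "sum \<pi> D * (sqrt g - m)\<^sup>2 \<le> 2 * (\<Sum>e\<in>D. \<pi> e * hellinger_sq (\<theta> e) g)"
      by (simp add: W_def sum_distrib_left mult_ac)
  qed
qed

section \<open>Tails of the log-likelihood ratio at a fixed parameter\<close>

locale observed_network =
  fixes E :: "'e set" and \<theta> \<pi> :: "'e \<Rightarrow> real" and \<gamma> \<rho> :: real
  assumes finite_E: "finite E"
    and \<theta>_range: "\<And>e. e \<in> E \<Longrightarrow> \<theta> e \<in> {\<gamma>..\<rho>}"
    and \<pi>_range: "\<And>e. e \<in> E \<Longrightarrow> \<pi> e \<in> {0..1}"
    and \<gamma>_pos: "0 < \<gamma>" and \<gamma>_le_\<rho>: "\<gamma> \<le> \<rho>" and \<rho>_less_1: "\<rho> < 1"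
begin

abbreviation "prob \<equiv> measure_pmf.prob (observed_edges E \<theta> \<pi>)"

definition log_loss :: "('e \<Rightarrow> real) \<Rightarrow> ('e \<Rightarrow> bool) \<times> ('e \<Rightarrow> bool) \<Rightarrow> real" where
  "log_loss q = observed_sum E (\<lambda>e. log_lik_ratio (\<theta> e) (q e))"

definition hellinger_risk :: "('e \<Rightarrow> real) \<Rightarrow> real" where
  "hellinger_risk q = (\<Sum>e\<in>E. \<pi> e * hellinger_sq (\<theta> e) (q e))"

definition kl_risk :: "('e \<Rightarrow> real) \<Rightarrow> real" where
  "kl_risk q = (\<Sum>e\<in>E. \<pi> e * kl_div (\<theta> e) (q e))"

text \<open>
  A squared condition number of the parameter range. Since \<open>\<kappa> \<ge> 1\<close>, it absorbs unconditioned
  remainders.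
\<close>

definition \<kappa> :: real where "\<kappa> = \<rho>\<^sup>2 / min ((1 - \<rho>)\<^sup>2) (\<gamma>\<^sup>2)"

lemma \<rho>_pos: "0 < \<rho>" using \<gamma>_pos \<gamma>_le_\<rho> by linarith

lemma unit_range: "q \<in> {\<gamma>..\<rho>} \<Longrightarrow> 0 < q \<and> q < 1"
  using \<gamma>_pos \<rho>_less_1 by auto

lemma \<theta>_unit: "e \<in> E \<Longrightarrow> 0 < \<theta> e \<and> \<theta> e < 1"
  using unit_range \<theta>_range by blast

text \<open>
  The last bound has only one factor \<open>\<rho>\<close> in the numerator. For \<open>\<rho> > 1 / 2\<close> the missing factor is at
  least \<open>1 / 2\<close>; for \<open>\<rho> \<le> 1 / 2\<close> the left-hand side is at most 4.
\<close>

lemma \<kappa>_bounds: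
  shows "1 \<le> \<kappa>" "\<rho> / \<gamma> \<le> \<kappa>" "\<rho> / (1 - \<rho>) \<le> \<kappa>" "\<rho>\<^sup>2 / \<gamma>\<^sup>2 \<le> \<kappa>" "\<rho> / (1 - \<rho>)\<^sup>2 \<le> 4 * \<kappa>"
proof -
  note p = \<rho>_pos \<gamma>_pos \<gamma>_le_\<rho> \<rho>_less_1
  show g: "\<rho>\<^sup>2 / \<gamma>\<^sup>2 \<le> \<kappa>" unfolding \<kappa>_def using p by (intro divide_left_mono) auto
  have r: "\<rho>\<^sup>2 / (1 - \<rho>)\<^sup>2 \<le> \<kappa>" unfolding \<kappa>_def using p by (intro divide_left_mono) (auto simp: min_def)
  have g1: "1 \<le> \<rho> / \<gamma>" using p by simp
  have "\<rho> / \<gamma> \<le> (\<rho> / \<gamma>)\<^sup>2" using mult_left_mono[OF g1, of "\<rho> / \<gamma>"] g1 by (simp only: power2_eq_square mult_1_right)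
  thus g2: "\<rho> / \<gamma> \<le> \<kappa>" using g by (simp add: power_divide)
  show one: "1 \<le> \<kappa>" using g1 g2 by linarith
  show "\<rho> / (1 - \<rho>) \<le> \<kappa>"
  proof (cases "\<rho> / (1 - \<rho>) \<le> 1")
    case False
    hence "\<rho> / (1 - \<rho>) * 1 \<le> \<rho> / (1 - \<rho>) * (\<rho> / (1 - \<rho>))" by (intro mult_left_mono) linarith+
    hence "\<rho> / (1 - \<rho>) \<le> (\<rho> / (1 - \<rho>))\<^sup>2" by (simp only: power2_eq_square mult_1_right)
    thus ?thesis using r by (simp add: power_divide)
  qed (use one in linarith)
  show "\<rho> / (1 - \<rho>)\<^sup>2 \<le> 4 * \<kappa>"
  proof (cases "\<rho> \<le> 1 / 2")
    case True
    have "(1 / 2)\<^sup>2 \<le> (1 - \<rho>)\<^sup>2" using True by (intro power_mono) auto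
    hence "\<rho> / (1 - \<rho>)\<^sup>2 \<le> 1 / (1 / 2)\<^sup>2" using p by (intro frac_le) auto
    thus ?thesis using one by (simp add: power2_eq_square)
  next
    case False
    hence "\<rho> * 1 \<le> \<rho> * (2 * \<rho>)" using p by (intro mult_left_mono) auto
    moreover have "0 \<le> \<rho> * (2 * \<rho>)" using p by simp
    ultimately have "\<rho> \<le> 4 * \<rho>\<^sup>2" unfolding power2_eq_square by linarith
    hence "\<rho> / (1 - \<rho>)\<^sup>2 \<le> (4 * \<rho>\<^sup>2) / (1 - \<rho>)\<^sup>2"
      by (intro divide_right_mono) auto
    thus ?thesis using r by simp
  qed
qed

text \<open>
  The factor \<open>exp (- hellinger_risk q / 2)\<close> in the probability is the half of the Hellinger risk
  that is held back; it makes the later union bound over a grid summable.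
\<close>

lemma log_loss_lower_tail:
  assumes q: "\<And>e. e \<in> E \<Longrightarrow> q e \<in> {\<gamma>..\<rho>}"
  shows "prob {\<omega>. log_loss q \<omega> + 2 * s \<le> hellinger_risk q} \<le> exp (- hellinger_risk q / 2 - s)"
proof -
  let ?\<phi> = "\<lambda>e a. - log_lik_ratio (\<theta> e) (q e) a / 2"
  have "observed_sum E ?\<phi> \<omega> = - log_loss q \<omega> / 2" for \<omega>
    by (simp add: log_loss_def observed_sum_def sum_divide_distrib sum_negf[symmetric] del: sum_negf)
  hence "{\<omega>. log_loss q \<omega> + 2 * s \<le> hellinger_risk q} = {\<omega>. s - hellinger_risk q / 2 \<le> observed_sum E ?\<phi> \<omega>}"
    by auto
  moreover have "prob {\<omega>. s - hellinger_risk q / 2 \<le> observed_sum E ?\<phi> \<omega>}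
     \<le> exp ((\<Sum>e\<in>E. \<pi> e * (\<theta> e * exp (?\<phi> e True) + (1 - \<theta> e) * exp (?\<phi> e False) - 1)) - (s - hellinger_risk q / 2))"
    using \<theta>_unit \<pi>_range by (intro observed_edges_chernoff finite_E) force+
  moreover have "(\<Sum>e\<in>E. \<pi> e * (\<theta> e * exp (?\<phi> e True) + (1 - \<theta> e) * exp (?\<phi> e False) - 1)) = - hellinger_risk q"
    unfolding hellinger_risk_def sum_negf[symmetric]
  proof (intro sum.cong refl)
    fix e assume "e \<in> E"
    with \<theta>_unit[of e] unit_range[OF q[of e]]
    show "\<pi> e * (\<theta> e * exp (?\<phi> e True) + (1 - \<theta> e) * exp (?\<phi> e False) - 1) = - (\<pi> e * hellinger_sq (\<theta> e) (q e))"
      by (subst half_log_lik_ratio_mgf) auto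
  qed
  ultimately show ?thesis by simp
qed

lemma log_lik_ratio_le_\<kappa>:
  assumes "p \<in> {\<gamma>..\<rho>}" "q \<in> {\<gamma>..\<rho>}"
  shows "log_lik_ratio p q a \<le> \<kappa>"
proof -
  have u: "0 < p" "p < 1" "0 < q" "q < 1" using unit_range assms by auto
  have "log_lik_ratio p q True \<le> p / q - 1" unfolding log_lik_ratio_def using u by (simp add: ln_le_minus_one)
  also have "\<dots> \<le> \<rho> / \<gamma>" using frac_le[of \<rho> p \<gamma> q] assms \<gamma>_pos by auto
  finally have 1: "log_lik_ratio p q True \<le> \<kappa>" using \<kappa>_bounds(2) by linarith
  have "log_lik_ratio p q False \<le> (1 - p) / (1 - q) - 1"
    unfolding log_lik_ratio_def using u by (simp add: ln_le_minus_one)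
  also have "\<dots> = (q - p) / (1 - q)" using u by (simp add: field_simps)
  also have "\<dots> \<le> \<rho> / (1 - \<rho>)" using assms u \<rho>_less_1 \<rho>_pos by (intro frac_le) auto
  finally have "log_lik_ratio p q False \<le> \<kappa>" using \<kappa>_bounds(3) by linarith
  with 1 show ?thesis by (cases a) auto
qed

lemma log_loss_upper_tail:
  assumes q: "\<And>e. e \<in> E \<Longrightarrow> q e \<in> {\<gamma>..\<rho>}"
  shows "prob {\<omega>. 5 * kl_risk q + \<kappa> * s \<le> log_loss q \<omega>} \<le> exp (- s)"
proof -
  have k: "0 < \<kappa>" using \<kappa>_bounds(1) by linarith
  let ?\<phi> = "\<lambda>e a. 1 / \<kappa> * log_lik_ratio (\<theta> e) (q e) a"
  have "observed_sum E ?\<phi> \<omega> = log_loss q \<omega> / \<kappa>" for \<omega>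
    by (simp add: log_loss_def observed_sum_def sum_divide_distrib)
  hence "{\<omega>. 5 * kl_risk q + \<kappa> * s \<le> log_loss q \<omega>} = {\<omega>. 5 * (1 / \<kappa>) * kl_risk q + s \<le> observed_sum E ?\<phi> \<omega>}"
    using k by (auto simp: field_simps)
  moreover have "prob {\<omega>. 5 * (1 / \<kappa>) * kl_risk q + s \<le> observed_sum E ?\<phi> \<omega>}
     \<le> exp ((\<Sum>e\<in>E. \<pi> e * (\<theta> e * exp (?\<phi> e True) + (1 - \<theta> e) * exp (?\<phi> e False) - 1)) - (5 * (1 / \<kappa>) * kl_risk q + s))"
    using \<theta>_unit \<pi>_range by (intro observed_edges_chernoff finite_E) force+
  moreover have "(\<Sum>e\<in>E. \<pi> e * (\<theta> e * exp (?\<phi> e True) + (1 - \<theta> e) * exp (?\<phi> e False) - 1)) \<le> 5 * (1 / \<kappa>) * kl_risk q"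
    unfolding kl_risk_def sum_distrib_left
  proof (rule sum_mono)
    fix e assume e: "e \<in> E"
    have "\<theta> e * exp (?\<phi> e True) + (1 - \<theta> e) * exp (?\<phi> e False) - 1 \<le> 5 * (1 / \<kappa>) * kl_div (\<theta> e) (q e)"
      using \<theta>_unit[OF e] unit_range[OF q[OF e]] k \<kappa>_bounds(1) log_lik_ratio_le_\<kappa>[OF \<theta>_range[OF e] q[OF e]]
      by (intro log_lik_ratio_mgf_le_kl) (auto simp: field_simps)
    hence "\<pi> e * (\<theta> e * exp (?\<phi> e True) + (1 - \<theta> e) * exp (?\<phi> e False) - 1) \<le> \<pi> e * (5 * (1 / \<kappa>) * kl_div (\<theta> e) (q e))"
      using \<pi>_range[OF e] by (intro mult_left_mono) auto
    thus "\<pi> e * (\<theta> e * exp (?\<phi> e True) + (1 - \<theta> e) * exp (?\<phi> e False) - 1)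
       \<le> 5 * (1 / \<kappa>) * (\<pi> e * kl_div (\<theta> e) (q e))" by (simp add: mult_ac)
  qed
  ultimately show ?thesis by (smt (verit) exp_le_cancel_iff)
qed

lemma norm_sq_le_hellinger_risk:
  assumes q: "\<And>e. e \<in> E \<Longrightarrow> q e \<in> {\<gamma>..\<rho>}"
  shows "(\<Sum>e\<in>E. \<pi> e * (\<theta> e - q e)\<^sup>2) \<le> 8 * \<rho> * hellinger_risk q"
  unfolding hellinger_risk_def sum_distrib_left
proof (rule sum_mono)
  fix e assume e: "e \<in> E"
  have "(\<theta> e - q e)\<^sup>2 \<le> 4 * \<rho> * (sqrt (\<theta> e) - sqrt (q e))\<^sup>2"
    using \<theta>_range[OF e] q[OF e] \<gamma>_pos by (intro diff_sq_le_sqrt) auto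
  also have "\<dots> \<le> 4 * \<rho> * (2 * hellinger_sq (\<theta> e) (q e))"
    using \<theta>_unit[OF e] unit_range[OF q[OF e]] \<rho>_pos by (intro mult_left_mono hellinger_sq_ge) auto
  finally have "\<pi> e * (\<theta> e - q e)\<^sup>2 \<le> \<pi> e * (4 * \<rho> * (2 * hellinger_sq (\<theta> e) (q e)))"
    using \<pi>_range[OF e] by (intro mult_left_mono) auto
  thus "\<pi> e * (\<theta> e - q e)\<^sup>2 \<le> 8 * \<rho> * (\<pi> e * hellinger_sq (\<theta> e) (q e))" by (simp add: mult_ac)
qed

end

section \<open>Uniform lower bound for block-constant parameters\<close>

text \<open>
  A labelling of the nodes groups the pairs into blocks on which the candidate parameters are
  constant; \<open>\<beta>\<close> assigns to each pair its block.
\<close>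

locale blocked_network = observed_network E \<theta> \<pi> \<gamma> \<rho>
  for E :: "'e set" and \<theta> \<pi> \<gamma> \<rho> +
  fixes B :: "'b set" and \<beta> :: "'e \<Rightarrow> 'b"
  assumes finite_B: "finite B" and \<beta>_in_B: "\<And>e. e \<in> E \<Longrightarrow> \<beta> e \<in> B"
begin

definition block :: "'b \<Rightarrow> 'e set" where "block b = {e \<in> E. \<beta> e = b}"

definition weight :: "'b \<Rightarrow> real" where "weight b = sum \<pi> (block b)"

text \<open>
  The number of observations that a block is credited with when its grid is chosen. The lower
  limit \<open>1 / \<rho>\<close> keeps \<open>1 / (\<rho> * resolution b)\<close> at most 1, as \<open>rounding_cost_tail\<close> requires; the
  grid of a block of smaller weight is correspondingly coarse.
\<close>

definition resolution :: "'b \<Rightarrow> real" where "resolution b = max (weight b) (1 / \<rho>)"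

definition grid :: "'b \<Rightarrow> real set" where "grid b = sqrt_grid \<gamma> \<rho> (resolution b)"

text \<open>
  Half of \<open>\<Sum>b. N b / w b + S b / (\<rho> * w b)\<close>, where \<open>w b\<close> is the resolution of block \<open>b\<close>, \<open>N b\<close> its
  number of observed pairs and \<open>S b\<close> its number of observed edges. Each of the two ratios has
  expectation at most 1, and the factor one half keeps the summands at most 1.
\<close>

definition rounding_cost :: "('e \<Rightarrow> bool) \<times> ('e \<Rightarrow> bool) \<Rightarrow> real" where
  "rounding_cost = observed_sum E
     (\<lambda>e a. (1 / resolution (\<beta> e)) / 2 + (if a then 1 / (\<rho> * resolution (\<beta> e)) / 2 else 0))"

lemma finite_block: "finite (block b)"
  using finite_E by (simp add: block_def)

lemma sum_block: "(\<Sum>b\<in>B. sum f (block b)) = sum f E"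
  unfolding block_def using \<beta>_in_B by (intro sum.group finite_E finite_B) auto

lemma weight_nonneg: "0 \<le> weight b"
  unfolding weight_def using \<pi>_range by (intro sum_nonneg) (auto simp: block_def)

lemma resolution_bounds: "0 < resolution b" "1 / \<rho> \<le> resolution b" "1 \<le> resolution b" "1 \<le> \<rho> * resolution b"
    "weight b / resolution b \<le> 1"
proof -
  have r: "1 \<le> 1 / \<rho>" using \<rho>_pos \<rho>_less_1 by simp
  show "1 / \<rho> \<le> resolution b" by (simp add: resolution_def)
  with r show "1 \<le> resolution b" by linarith
  thus "0 < resolution b" by linarith
  thus "weight b / resolution b \<le> 1" by (simp add: resolution_def divide_le_eq)
  show "1 \<le> \<rho> * resolution b" using \<open>1 / \<rho> \<le> resolution b\<close> \<rho>_pos by (simp add: field_simps)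
qed

lemma sum_\<pi>_resolution: "(\<Sum>e\<in>E. \<pi> e * (c / resolution (\<beta> e))) \<le> \<bar>c\<bar> * real (card B)"
proof -
  have "(\<Sum>e\<in>E. \<pi> e * (c / resolution (\<beta> e))) = (\<Sum>b\<in>B. \<Sum>e\<in>block b. \<pi> e * (c / resolution (\<beta> e)))"
    by (simp add: sum_block)
  also have "\<dots> = (\<Sum>b\<in>B. c * (weight b / resolution b))"
    by (intro sum.cong refl) (simp add: block_def weight_def sum_distrib_right sum_distrib_left mult_ac flip: sum_divide_distrib)
  also have "\<dots> \<le> (\<Sum>b\<in>B. \<bar>c\<bar>)"
  proof (rule sum_mono)
    fix b
    have "c * (weight b / resolution b) \<le> \<bar>c\<bar> * (weight b / resolution b)"
      using weight_nonneg[of b] resolution_bounds(1)[of b] by (intro mult_right_mono) auto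
    also have "\<dots> \<le> \<bar>c\<bar> * 1" using resolution_bounds(5) by (intro mult_left_mono) auto
    finally show "c * (weight b / resolution b) \<le> \<bar>c\<bar>" by simp
  qed
  finally show ?thesis by (simp add: mult.commute)
qed

text \<open>
  Since each summand lies in \<open>[0, 1]\<close>, where \<open>exp x \<le> 1 + 2 * x\<close>, the exponential moment is
  governed by twice the expectation; the expectation itself is at most one per block.
\<close>

lemma rounding_cost_tail: "prob {\<omega>. 2 * real (card B) + s \<le> rounding_cost \<omega>} \<le> exp (- s)"
proof -
  let ?\<phi> = "\<lambda>e a. (1 / resolution (\<beta> e)) / 2 + (if a then 1 / (\<rho> * resolution (\<beta> e)) / 2 else 0)"
  have ex: "exp x \<le> 1 + 2 * x" if "0 \<le> x" "x \<le> 1" for x :: real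
  proof -
    have "x\<^sup>2 \<le> x" using that by (simp add: power2_eq_square mult_left_le_one_le)
    thus ?thesis using exp_bound[OF that] by linarith
  qed
  have "(\<Sum>e\<in>E. \<pi> e * (\<theta> e * exp (?\<phi> e True) + (1 - \<theta> e) * exp (?\<phi> e False) - 1))
     \<le> (\<Sum>e\<in>E. \<pi> e * (2 / resolution (\<beta> e)))"
  proof (intro sum_mono mult_left_mono)
    fix e assume e: "e \<in> E"
    define w where "w = resolution (\<beta> e)"
    have w: "1 \<le> w" "1 \<le> \<rho> * w" using resolution_bounds unfolding w_def by auto
    have b: "0 \<le> 1 / w" "1 / w \<le> 1" "0 \<le> 1 / (\<rho> * w)" "1 / (\<rho> * w) \<le> 1" using w by auto
    have t: "0 \<le> \<theta> e" "\<theta> e \<le> \<rho>" "\<theta> e \<le> 1" using \<theta>_unit[OF e] \<theta>_range[OF e] by auto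
    have "\<theta> e * exp (?\<phi> e True) + (1 - \<theta> e) * exp (?\<phi> e False) - 1
      \<le> \<theta> e * (1 + 2 * ?\<phi> e True) + (1 - \<theta> e) * (1 + 2 * ?\<phi> e False) - 1"
      using t b unfolding w_def[symmetric] by (intro diff_right_mono add_mono mult_left_mono ex) auto
    also have "\<dots> = 1 / w + \<theta> e * (1 / (\<rho> * w))"
      by (simp add: w_def[symmetric] add_divide_distrib[symmetric] distrib_left right_diff_distrib)
    also have "\<theta> e * (1 / (\<rho> * w)) \<le> \<rho> * (1 / (\<rho> * w))"
      using t b by (intro mult_right_mono) auto
    also have "\<rho> * (1 / (\<rho> * w)) = 1 / w" using \<rho>_pos by simp
    finally show "\<theta> e * exp (?\<phi> e True) + (1 - \<theta> e) * exp (?\<phi> e False) - 1 \<le> 2 / resolution (\<beta> e)"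
      by (simp add: w_def)
  qed (use \<pi>_range in auto)
  also have "\<dots> \<le> \<bar>2\<bar> * real (card B)" by (rule sum_\<pi>_resolution)
  finally have mgf: "(\<Sum>e\<in>E. \<pi> e * (\<theta> e * exp (?\<phi> e True) + (1 - \<theta> e) * exp (?\<phi> e False) - 1)) \<le> 2 * real (card B)"
    by simp
  have "prob {\<omega>. 2 * real (card B) + s \<le> rounding_cost \<omega>}
     \<le> exp ((\<Sum>e\<in>E. \<pi> e * (\<theta> e * exp (?\<phi> e True) + (1 - \<theta> e) * exp (?\<phi> e False) - 1)) - (2 * real (card B) + s))"
    unfolding rounding_cost_def using \<theta>_unit \<pi>_range by (intro observed_edges_chernoff finite_E) force+
  also have "\<dots> \<le> exp (- s)" using mgf by simp
  finally show ?thesis .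
qed

text \<open>
  The grid of matrices is a product over blocks, and \<open>exp (- hellinger_risk / 2)\<close> factorises over
  blocks. So the union bound over the product grid is a product of Gaussian sums, each at most
  \<open>exp 3\<close>; the offset \<open>3 * card B\<close> cancels exactly this product.
\<close>

lemma grid_lower_tail:
  "prob {\<omega>. \<exists>g\<in>PiE B grid. log_loss (g \<circ> \<beta>) \<omega> + 2 * (3 * real (card B) + s) \<le> hellinger_risk (g \<circ> \<beta>)} \<le> exp (- s)"
proof -
  have grid: "finite (grid b)" "grid b \<subseteq> {\<gamma>..\<rho>}" for b
    unfolding grid_def using finite_sqrt_grid sqrt_grid_subset \<gamma>_le_\<rho> by auto
  have fin: "finite (PiE B grid)" by (intro finite_PiE finite_B grid)
  have in_range: "(g \<circ> \<beta>) e \<in> {\<gamma>..\<rho>}" if "g \<in> PiE B grid" "e \<in> E" for g e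
    using that grid(2)[of "\<beta> e"] \<beta>_in_B[of e] by (auto simp: PiE_mem)
  let ?h = "\<lambda>b g. (\<Sum>e\<in>block b. \<pi> e * hellinger_sq (\<theta> e) g)"
  have block_sum: "(\<Sum>g\<in>grid b. exp (- ?h b g / 2)) \<le> exp 3" for b
  proof -
    have "\<exists>m. \<forall>g\<in>{0..1}. sum \<pi> (block b) * (sqrt g - m)\<^sup>2 \<le> 2 * ?h b g"
      using \<theta>_unit \<pi>_range by (intro block_hellinger_ge finite_block) (force simp: block_def)+
    then obtain m where m: "weight b * (sqrt g - m)\<^sup>2 \<le> 2 * ?h b g" if "g \<in> {0..1}" for g
      unfolding weight_def by blast
    have "(\<Sum>g\<in>grid b. exp (- ?h b g / 2)) \<le> (\<Sum>g\<in>grid b. exp (- (weight b * (sqrt g - m)\<^sup>2) / 4))"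
    proof (rule sum_mono)
      fix g assume "g \<in> grid b"
      hence "g \<in> {0..1}" using grid(2)[of b] unit_range[of g] by fastforce
      from m[OF this] show "exp (- ?h b g / 2) \<le> exp (- (weight b * (sqrt g - m)\<^sup>2) / 4)" by simp
    qed
    also have "\<dots> \<le> exp 3" unfolding grid_def resolution_def
      using \<gamma>_pos \<gamma>_le_\<rho> weight_nonneg by (intro sqrt_grid_gaussian_sum) auto
    finally show ?thesis .
  qed
  have risk: "exp (- hellinger_risk (g \<circ> \<beta>) / 2) = (\<Prod>b\<in>B. exp (- ?h b (g b) / 2))" for g
  proof -
    have "hellinger_risk (g \<circ> \<beta>) = (\<Sum>b\<in>B. ?h b (g b))"
      unfolding hellinger_risk_def sum_block[symmetric]
      by (intro sum.cong refl) (auto simp: block_def)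
    thus ?thesis by (simp add: exp_sum finite_B sum_divide_distrib sum_negf[symmetric] del: sum_negf flip: exp_sum)
  qed
  have "(\<Sum>g\<in>PiE B grid. exp (- hellinger_risk (g \<circ> \<beta>) / 2)) = (\<Prod>b\<in>B. \<Sum>g\<in>grid b. exp (- ?h b g / 2))"
    unfolding risk by (rule prod_sum_PiE[symmetric]) (use finite_B grid in auto)
  also have "\<dots> \<le> (\<Prod>b\<in>B. exp 3)"
    by (intro prod_mono conjI block_sum sum_nonneg) auto
  also have "\<dots> = exp (3 * real (card B))" by (simp add: exp_of_nat2_mult)
  finally have grid_sum: "(\<Sum>g\<in>PiE B grid. exp (- hellinger_risk (g \<circ> \<beta>) / 2)) \<le> exp (3 * real (card B))" .
  have "{\<omega>. \<exists>g\<in>PiE B grid. log_loss (g \<circ> \<beta>) \<omega> + 2 * (3 * real (card B) + s) \<le> hellinger_risk (g \<circ> \<beta>)}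
     = (\<Union>g\<in>PiE B grid. {\<omega>. log_loss (g \<circ> \<beta>) \<omega> + 2 * (3 * real (card B) + s) \<le> hellinger_risk (g \<circ> \<beta>)})"
    by auto
  hence "prob {\<omega>. \<exists>g\<in>PiE B grid. log_loss (g \<circ> \<beta>) \<omega> + 2 * (3 * real (card B) + s) \<le> hellinger_risk (g \<circ> \<beta>)}
     \<le> (\<Sum>g\<in>PiE B grid. prob {\<omega>. log_loss (g \<circ> \<beta>) \<omega> + 2 * (3 * real (card B) + s) \<le> hellinger_risk (g \<circ> \<beta>)})"
    using fin by (simp only:) (intro measure_UNION_le; simp)
  also have "\<dots> \<le> (\<Sum>g\<in>PiE B grid. exp (- hellinger_risk (g \<circ> \<beta>) / 2 - (3 * real (card B) + s)))"
    using in_range by (intro sum_mono log_loss_lower_tail)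
  also have "\<dots> = (\<Sum>g\<in>PiE B grid. exp (- hellinger_risk (g \<circ> \<beta>) / 2)) * exp (- (3 * real (card B) + s))"
    by (simp only: sum_distrib_right exp_add[symmetric] diff_conv_add_uminus)
  also have "\<dots> \<le> exp (3 * real (card B)) * exp (- (3 * real (card B) + s))"
    by (intro mult_right_mono grid_sum) simp
  also have "\<dots> = exp (- s)"
    by (simp add: exp_add[symmetric])
  finally show ?thesis .
qed

end

lemma log_lik_ratio_trans:
  assumes "0 < p" "p < 1" "0 < q" "q < 1" "0 < r" "r < 1"
  shows "log_lik_ratio p r a = log_lik_ratio p q a + log_lik_ratio q r a"
  using assms by (simp add: log_lik_ratio_def ln_div)

context blocked_network
begin

text \<open>
  Rounding is done block by block, so each block may choose its more favourable neighbour. The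
  squared distance \<open>4 * \<rho> / resolution b\<close> divided by \<open>\<gamma>\<^sup>2\<close> or \<open>(1 - \<rho>)\<^sup>2\<close> is at most a multiple of \<open>\<kappa>\<close> times
  the corresponding summand of \<open>rounding_cost\<close>. The extra \<open>1 / \<rho>\<close> available for observed edges is
  what makes the factor \<open>\<rho> / \<gamma>\<^sup>2\<close> affordable.
\<close>

lemma rounding_to_grid:
  assumes q: "\<And>b. b \<in> B \<Longrightarrow> q b \<in> {\<gamma>..\<rho>}"
  shows "\<exists>g\<in>PiE B grid. log_loss (g \<circ> \<beta>) \<omega> \<le> log_loss (q \<circ> \<beta>) \<omega> + 32 * \<kappa> * rounding_cost \<omega> \<and>
    (\<forall>b\<in>B. (g b - q b)\<^sup>2 \<le> 4 * \<rho> / resolution b)"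
proof -
  obtain a x where \<omega>: "\<omega> = (a, x)" by fastforce
  define S where "S b = (\<Sum>e\<in>block b. of_bool (x e \<and> a e) :: real)" for b
  define T where "T b = (\<Sum>e\<in>block b. of_bool (x e \<and> \<not> a e) :: real)" for b
  let ?d = "\<lambda>b. 4 * \<rho> / resolution b"
  have "\<exists>g. g \<in> grid b \<and> (g - q b)\<^sup>2 \<le> ?d b \<and>
      S b * log_lik_ratio (q b) g True + T b * log_lik_ratio (q b) g False \<le> ?d b * (S b / \<gamma>\<^sup>2 + T b / (1 - \<rho>)\<^sup>2)" if b: "b \<in> B" for b
  proof -
    have qb: "\<gamma> \<le> q b" "q b \<le> \<rho>" using q[OF b] by auto
    obtain g1 g2 where g: "g1 \<in> grid b" "g2 \<in> grid b" "g1 \<le> q b" "q b \<le> g2"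
      "(g1 - q b)\<^sup>2 \<le> ?d b" "(g2 - q b)\<^sup>2 \<le> ?d b"
      using sqrt_grid_neighbours[OF \<gamma>_pos qb resolution_bounds(1)[of b]] unfolding grid_def by blast
    have "g1 \<in> {\<gamma>..\<rho>}" "g2 \<in> {\<gamma>..\<rho>}"
      using g(1,2) sqrt_grid_subset[OF \<gamma>_le_\<rho>] unfolding grid_def by blast+
    hence "\<exists>g\<in>{g1, g2}. S b * log_lik_ratio (q b) g True + T b * log_lik_ratio (q b) g False \<le> ?d b * (S b / \<gamma>\<^sup>2 + T b / (1 - \<rho>)\<^sup>2)"
      using g \<gamma>_pos \<rho>_less_1 by (intro log_lik_ratio_rounding) (auto simp: S_def T_def intro!: sum_nonneg)
    thus ?thesis using g by blast
  qed
  then obtain g0 where g0: "\<And>b. b \<in> B \<Longrightarrow> g0 b \<in> grid b \<and> (g0 b - q b)\<^sup>2 \<le> ?d b \<and>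
      S b * log_lik_ratio (q b) (g0 b) True + T b * log_lik_ratio (q b) (g0 b) False \<le> ?d b * (S b / \<gamma>\<^sup>2 + T b / (1 - \<rho>)\<^sup>2)"
    by metis
  define g where "g = restrict g0 B"
  have g: "g b \<in> grid b" "(g b - q b)\<^sup>2 \<le> ?d b"
      "S b * log_lik_ratio (q b) (g b) True + T b * log_lik_ratio (q b) (g b) False \<le> ?d b * (S b / \<gamma>\<^sup>2 + T b / (1 - \<rho>)\<^sup>2)" if "b \<in> B" for b
    using g0[OF that] that by (auto simp: g_def)
  have gr: "g b \<in> {\<gamma>..\<rho>}" if "b \<in> B" for b
    using g(1)[OF that] sqrt_grid_subset[OF \<gamma>_le_\<rho>] unfolding grid_def by blast
  have split: "(\<Sum>e\<in>block b. of_bool (x e) * (if a e then u else v)) = S b * u + T b * v" for b u v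
    unfolding S_def T_def sum_distrib_right sum.distrib[symmetric] by (intro sum.cong) auto
  have "log_loss (g \<circ> \<beta>) \<omega> = log_loss (q \<circ> \<beta>) \<omega> + (\<Sum>e\<in>E. of_bool (x e) * log_lik_ratio (q (\<beta> e)) (g (\<beta> e)) (a e))"
    unfolding log_loss_def observed_sum_def sum.distrib[symmetric]
  proof (intro sum.cong refl)
    fix e assume e: "e \<in> E"
    have "log_lik_ratio (\<theta> e) (g (\<beta> e)) (a e) = log_lik_ratio (\<theta> e) (q (\<beta> e)) (a e) + log_lik_ratio (q (\<beta> e)) (g (\<beta> e)) (a e)"
      using \<theta>_unit[OF e] unit_range[OF q[OF \<beta>_in_B[OF e]]] unit_range[OF gr[OF \<beta>_in_B[OF e]]]
      by (intro log_lik_ratio_trans) auto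
    thus "of_bool (snd \<omega> e) * log_lik_ratio (\<theta> e) ((g \<circ> \<beta>) e) (fst \<omega> e) =
         of_bool (snd \<omega> e) * log_lik_ratio (\<theta> e) ((q \<circ> \<beta>) e) (fst \<omega> e) + of_bool (x e) * log_lik_ratio (q (\<beta> e)) (g (\<beta> e)) (a e)"
      by (simp add: \<omega> ring_distribs)
  qed
  also have "(\<Sum>e\<in>E. of_bool (x e) * log_lik_ratio (q (\<beta> e)) (g (\<beta> e)) (a e))
      = (\<Sum>b\<in>B. \<Sum>e\<in>block b. of_bool (x e) * log_lik_ratio (q (\<beta> e)) (g (\<beta> e)) (a e))"
    by (simp only: sum_block)
  also have "\<dots> = (\<Sum>b\<in>B. S b * log_lik_ratio (q b) (g b) True + T b * log_lik_ratio (q b) (g b) False)"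
    unfolding split[symmetric] by (intro sum.cong refl) (auto simp: block_def)
  also have "\<dots> \<le> (\<Sum>b\<in>B. ?d b * (S b / \<gamma>\<^sup>2 + T b / (1 - \<rho>)\<^sup>2))"
    by (intro sum_mono g)
  also have "\<dots> = (\<Sum>b\<in>B. \<Sum>e\<in>block b. of_bool (x e) * (if a e then ?d b / \<gamma>\<^sup>2 else ?d b / (1 - \<rho>)\<^sup>2))"
    unfolding split by (intro sum.cong refl) (simp add: algebra_simps)
  also have "\<dots> = (\<Sum>b\<in>B. \<Sum>e\<in>block b. of_bool (x e) * (if a e then ?d (\<beta> e) / \<gamma>\<^sup>2 else ?d (\<beta> e) / (1 - \<rho>)\<^sup>2))"
    by (intro sum.cong refl) (auto simp: block_def)
  also have "\<dots> = (\<Sum>e\<in>E. of_bool (x e) * (if a e then ?d (\<beta> e) / \<gamma>\<^sup>2 else ?d (\<beta> e) / (1 - \<rho>)\<^sup>2))"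
    by (rule sum_block)
  also have "\<dots> \<le> 32 * \<kappa> * rounding_cost \<omega>"
    unfolding rounding_cost_def observed_sum_def sum_distrib_left
  proof (rule sum_mono)
    fix e assume "e \<in> E"
    define w where "w = resolution (\<beta> e)"
    have w: "0 < w" using resolution_bounds(1) by (simp add: w_def)
    have k: "0 < \<kappa>" using \<kappa>_bounds(1) by linarith
    have 1: "4 * \<rho> / w / \<gamma>\<^sup>2 \<le> 16 * \<kappa> / (\<rho> * w)"
    proof -
      have "4 * \<rho> / w / \<gamma>\<^sup>2 = 4 * (\<rho>\<^sup>2 / \<gamma>\<^sup>2) / (\<rho> * w)"
        using \<rho>_pos by (simp add: power2_eq_square)
      also have "\<dots> \<le> 16 * \<kappa> / (\<rho> * w)"
        using \<kappa>_bounds(4) \<rho>_pos w k by (intro divide_right_mono) auto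
      finally show ?thesis .
    qed
    have 2: "4 * \<rho> / w / (1 - \<rho>)\<^sup>2 \<le> 16 * \<kappa> / w"
    proof -
      have "4 * \<rho> / w / (1 - \<rho>)\<^sup>2 = 4 * (\<rho> / (1 - \<rho>)\<^sup>2) / w" by simp
      also have "\<dots> \<le> 16 * \<kappa> / w" using \<kappa>_bounds(5) w by (intro divide_right_mono) auto
      finally show ?thesis .
    qed
    have 3: "0 \<le> 16 * \<kappa> / w" using k w by simp
    have "(if a e then 4 * \<rho> / w / \<gamma>\<^sup>2 else 4 * \<rho> / w / (1 - \<rho>)\<^sup>2)
        \<le> 32 * \<kappa> * (1 / w / 2 + (if a e then 1 / (\<rho> * w) / 2 else 0))"
    proof -
      have "32 * \<kappa> * (1 / w / 2 + (if a e then 1 / (\<rho> * w) / 2 else 0))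
          = 16 * \<kappa> / w + (if a e then 16 * \<kappa> / (\<rho> * w) else 0)"
        by (simp add: algebra_simps)
      moreover have "(if a e then 4 * \<rho> / w / \<gamma>\<^sup>2 else 4 * \<rho> / w / (1 - \<rho>)\<^sup>2)
          \<le> 16 * \<kappa> / w + (if a e then 16 * \<kappa> / (\<rho> * w) else 0)"
        using 2 add_mono[OF 3 1] by (simp del: times_divide_times_eq divide_divide_eq_left)
      ultimately show ?thesis by (simp only:)
    qed
    hence "of_bool (x e) * (if a e then 4 * \<rho> / w / \<gamma>\<^sup>2 else 4 * \<rho> / w / (1 - \<rho>)\<^sup>2)
       \<le> of_bool (x e) * (32 * \<kappa> * (1 / w / 2 + (if a e then 1 / (\<rho> * w) / 2 else 0)))"
      by (rule mult_left_mono) simp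
    thus "of_bool (x e) * (if a e then ?d (\<beta> e) / \<gamma>\<^sup>2 else ?d (\<beta> e) / (1 - \<rho>)\<^sup>2)
      \<le> 32 * \<kappa> * (of_bool (snd \<omega> e) * (1 / resolution (\<beta> e) / 2 + (if fst \<omega> e then 1 / (\<rho> * resolution (\<beta> e)) / 2 else 0)))"
      unfolding w_def[symmetric] \<omega> fst_conv snd_conv by (simp only: mult_ac)
  qed
  finally have "log_loss (g \<circ> \<beta>) \<omega> \<le> log_loss (q \<circ> \<beta>) \<omega> + 32 * \<kappa> * rounding_cost \<omega>"
    by (simp add: o_def)
  moreover have "g \<in> PiE B grid" using g(1) by (auto simp: g_def)
  ultimately show ?thesis using g(2) by blast
qed

text \<open>
  Bound the Hellinger risk at a rounded parameter \<open>g\<close> by the loss at \<open>g\<close>, the loss at \<open>g\<close> by the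
  loss at \<open>q\<close> plus the rounding cost, and the squared error at \<open>q\<close> by those at \<open>g\<close> and between \<open>g\<close>
  and \<open>q\<close>. The bad event depends only on the grid, hence the bound is uniform in \<open>q\<close>.
\<close>

lemma uniform_risk_bound:
  "prob {\<omega>. \<exists>q. (\<forall>b\<in>B. q b \<in> {\<gamma>..\<rho>}) \<and>
      16 * \<rho> * log_loss (q \<circ> \<beta>) \<omega> + 1128 * \<rho> * \<kappa> * (real (card B) + s) < (\<Sum>e\<in>E. \<pi> e * (\<theta> e - q (\<beta> e))\<^sup>2)}
    \<le> 2 * exp (- s)" (is "prob ?bad \<le> _") if "0 \<le> s"
proof -
  define bad1 where "bad1 = {\<omega>. \<exists>g\<in>PiE B grid. log_loss (g \<circ> \<beta>) \<omega> + 2 * (3 * real (card B) + s) \<le> hellinger_risk (g \<circ> \<beta>)}"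
  define bad2 where "bad2 = {\<omega>. 2 * real (card B) + s \<le> rounding_cost \<omega>}"
  have "?bad \<subseteq> bad1 \<union> bad2"
  proof (rule subsetI, rule ccontr)
    fix \<omega> assume "\<omega> \<in> ?bad" and good: "\<omega> \<notin> bad1 \<union> bad2"
    then obtain q where q: "\<And>b. b \<in> B \<Longrightarrow> q b \<in> {\<gamma>..\<rho>}"
      and large: "16 * \<rho> * log_loss (q \<circ> \<beta>) \<omega> + 1128 * \<rho> * \<kappa> * (real (card B) + s) < (\<Sum>e\<in>E. \<pi> e * (\<theta> e - q (\<beta> e))\<^sup>2)"
      by auto
    obtain g where g: "g \<in> PiE B grid"
      and loss: "log_loss (g \<circ> \<beta>) \<omega> \<le> log_loss (q \<circ> \<beta>) \<omega> + 32 * \<kappa> * rounding_cost \<omega>"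
      and close: "\<And>b. b \<in> B \<Longrightarrow> (g b - q b)\<^sup>2 \<le> 4 * \<rho> / resolution b"
      using rounding_to_grid[of q \<omega>] q by blast
    have gr: "(g \<circ> \<beta>) e \<in> {\<gamma>..\<rho>}" if "e \<in> E" for e
    proof -
      have "g (\<beta> e) \<in> grid (\<beta> e)" using g \<beta>_in_B[OF that] by auto
      thus ?thesis using sqrt_grid_subset[OF \<gamma>_le_\<rho>] unfolding grid_def o_apply by blast
    qed
    have k: "1 \<le> \<kappa>" by (rule \<kappa>_bounds)
    have n: "0 \<le> real (card B)" by simp
    have "\<kappa> * rounding_cost \<omega> \<le> \<kappa> * (2 * real (card B) + s)"
      using good k by (intro mult_left_mono) (auto simp: bad2_def)
    moreover have "hellinger_risk (g \<circ> \<beta>) \<le> log_loss (g \<circ> \<beta>) \<omega> + 2 * (3 * real (card B) + s)"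
      using good g by (force simp: bad1_def)
    ultimately have "hellinger_risk (g \<circ> \<beta>) \<le> log_loss (q \<circ> \<beta>) \<omega> + 6 * real (card B) + 2 * s + 64 * (\<kappa> * real (card B)) + 32 * (\<kappa> * s)"
      using loss by (simp add: algebra_simps)
    moreover have "real (card B) \<le> \<kappa> * real (card B)" "s \<le> \<kappa> * s"
      using mult_right_mono[OF k n] mult_right_mono[OF k that] by simp_all
    ultimately have "hellinger_risk (g \<circ> \<beta>) \<le> log_loss (q \<circ> \<beta>) \<omega> + 70 * (\<kappa> * real (card B)) + 34 * (\<kappa> * s)"
      by linarith
    hence "8 * \<rho> * hellinger_risk (g \<circ> \<beta>) \<le> 8 * \<rho> * (log_loss (q \<circ> \<beta>) \<omega> + 70 * (\<kappa> * real (card B)) + 34 * (\<kappa> * s))"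
      using \<rho>_pos by (intro mult_left_mono) auto
    hence far: "(\<Sum>e\<in>E. \<pi> e * (\<theta> e - (g \<circ> \<beta>) e)\<^sup>2) \<le> 8 * \<rho> * (log_loss (q \<circ> \<beta>) \<omega> + 70 * (\<kappa> * real (card B)) + 34 * (\<kappa> * s))"
      using norm_sq_le_hellinger_risk[of "g \<circ> \<beta>", OF gr] by linarith
    have "(\<Sum>e\<in>E. \<pi> e * (g (\<beta> e) - q (\<beta> e))\<^sup>2) \<le> (\<Sum>e\<in>E. \<pi> e * (4 * \<rho> / resolution (\<beta> e)))"
      using close \<beta>_in_B \<pi>_range by (intro sum_mono mult_left_mono) auto
    also have "\<dots> \<le> \<bar>4 * \<rho>\<bar> * real (card B)" by (rule sum_\<pi>_resolution)
    also have "\<dots> \<le> 4 * \<rho> * (\<kappa> * real (card B))"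
      using \<open>real (card B) \<le> \<kappa> * real (card B)\<close> \<rho>_pos by simp
    finally have near: "(\<Sum>e\<in>E. \<pi> e * (g (\<beta> e) - q (\<beta> e))\<^sup>2) \<le> 4 * \<rho> * (\<kappa> * real (card B))" .
    have "(\<Sum>e\<in>E. \<pi> e * (\<theta> e - q (\<beta> e))\<^sup>2)
       \<le> (\<Sum>e\<in>E. 2 * (\<pi> e * (\<theta> e - (g \<circ> \<beta>) e)\<^sup>2) + 2 * (\<pi> e * (g (\<beta> e) - q (\<beta> e))\<^sup>2))"
    proof (rule sum_mono)
      fix e assume e: "e \<in> E"
      have "(u - v)\<^sup>2 \<le> 2 * (u - w)\<^sup>2 + 2 * (w - v)\<^sup>2" for u v w :: real
        using zero_le_power2[of "(u - w) - (w - v)"] by (simp add: power2_eq_square algebra_simps)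
      hence "\<pi> e * (\<theta> e - q (\<beta> e))\<^sup>2 \<le> \<pi> e * (2 * (\<theta> e - (g \<circ> \<beta>) e)\<^sup>2 + 2 * ((g \<circ> \<beta>) e - q (\<beta> e))\<^sup>2)"
        using \<pi>_range[OF e] by (intro mult_left_mono) auto
      thus "\<pi> e * (\<theta> e - q (\<beta> e))\<^sup>2 \<le> 2 * (\<pi> e * (\<theta> e - (g \<circ> \<beta>) e)\<^sup>2) + 2 * (\<pi> e * (g (\<beta> e) - q (\<beta> e))\<^sup>2)"
        by (simp add: algebra_simps)
    qed
    also have "\<dots> \<le> 2 * (8 * \<rho> * (log_loss (q \<circ> \<beta>) \<omega> + 70 * (\<kappa> * real (card B)) + 34 * (\<kappa> * s))) + 2 * (4 * \<rho> * (\<kappa> * real (card B)))"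
      using far near by (simp only: sum.distrib sum_distrib_left[symmetric])
    also have "\<dots> = 16 * \<rho> * log_loss (q \<circ> \<beta>) \<omega> + 1128 * \<rho> * \<kappa> * real (card B) + 544 * \<rho> * \<kappa> * s"
      by (simp add: algebra_simps)
    also have "\<dots> \<le> 16 * \<rho> * log_loss (q \<circ> \<beta>) \<omega> + 1128 * \<rho> * \<kappa> * real (card B) + 1128 * \<rho> * \<kappa> * s"
      using \<rho>_pos k that by (intro add_left_mono mult_right_mono) auto
    finally show False using large by (simp add: algebra_simps)
  qed
  hence "prob ?bad \<le> prob (bad1 \<union> bad2)" by (intro measure_pmf.finite_measure_mono) auto
  also have "\<dots> \<le> prob bad1 + prob bad2" by (intro measure_Un_le) auto
  also have "\<dots> \<le> exp (- s) + exp (- s)"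
    unfolding bad1_def bad2_def by (intro add_mono grid_lower_tail rounding_cost_tail)
  finally show ?thesis by simp
qed

end

section \<open>Clipping the oracle\<close>

lemma kl_div_nonneg:
  assumes "0 < p" "p < 1" "0 < q" "q < 1"
  shows "0 \<le> kl_div p q"
proof -
  have *: "x - y \<le> x * ln (x / y)" if "0 < x" "0 < y" for x y :: real
  proof -
    have "x * ln (y / x) \<le> x * (y / x - 1)"
      using that by (intro mult_left_mono ln_le_minus_one) auto
    thus ?thesis using that by (simp add: ln_div algebra_simps)
  qed
  show ?thesis using *[of p q] *[of "1 - p" "1 - q"] assms by (simp add: kl_div_def)
qed

lemma kl_bernoulli_eq_kl_div:
  assumes "0 < p" "p < 1" "0 < q" "q < 1"
  shows "kl_bernoulli p q = ereal (kl_div p q)"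
  using assms by (simp add: kl_bernoulli_def kl_term_def kl_div_def)

text \<open>
  By \<open>ln t \<ge> 1 - 1 / t\<close>, the difference of the two divergences is at least
  \<open>(c - q) * (p - c) / (c * (1 - c))\<close>, which is nonnegative exactly when \<open>c\<close> lies between \<open>q\<close> and \<open>p\<close>.
\<close>

lemma kl_div_between:
  assumes "0 < p" "p < 1" "0 < q" "q < 1" and "q \<le> c \<and> c \<le> p \<or> p \<le> c \<and> c \<le> q"
  shows "kl_div p c \<le> kl_div p q"
proof -
  have c: "0 < c" "c < 1" using assms by auto
  have lnb: "(x - y) / x \<le> ln (x / y)" if "0 < x" "0 < y" for x y :: real
  proof -
    have "ln (y / x) \<le> y / x - 1" using that by (intro ln_le_minus_one) auto
    thus ?thesis using that by (simp add: ln_div diff_divide_distrib)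
  qed
  have "0 \<le> (c - q) * (p - c)"
    using assms by (auto intro: mult_nonneg_nonneg mult_nonpos_nonpos)
  hence "0 \<le> (c - q) * (p - c) / (c * (1 - c))" using c by auto
  also have "\<dots> = p * ((c - q) / c) + (1 - p) * (((1 - c) - (1 - q)) / (1 - c))"
    using c by (simp add: divide_simps) (simp add: algebra_simps)
  also have "\<dots> \<le> p * ln (c / q) + (1 - p) * ln ((1 - c) / (1 - q))"
    using assms c by (intro add_mono mult_left_mono lnb) auto
  also have "\<dots> = kl_div p q - kl_div p c"
    using assms c by (simp add: kl_div_def ln_div algebra_simps)
  finally show ?thesis by simp
qed

definition clip :: "real \<Rightarrow> real \<Rightarrow> real \<Rightarrow> real" where
  "clip \<gamma> \<rho> q = max \<gamma> (min \<rho> q)"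

text \<open>
  The oracle may have entries 0 or 1; there the divergence from \<open>p\<close> is infinite.
\<close>

lemma kl_div_clip_le:
  assumes "0 < \<gamma>" "\<gamma> \<le> p" "p \<le> \<rho>" "\<rho> < 1" "0 \<le> q" "q \<le> 1"
  shows "ereal (kl_div p (clip \<gamma> \<rho> q)) \<le> kl_bernoulli p q"
proof (cases "0 < q \<and> q < 1")
  case True
  thus ?thesis using assms
    by (subst kl_bernoulli_eq_kl_div) (auto simp: clip_def intro!: kl_div_between)
next
  case False
  hence "q = 0 \<or> q = 1" using assms by auto
  hence "kl_bernoulli p q = \<infinity>" using assms by (auto simp: kl_bernoulli_def kl_term_def)
  thus ?thesis by simp
qed

section \<open>From matrices to families of pairs\<close>

definition edge_matrix :: "(nat \<times> nat \<Rightarrow> bool) \<Rightarrow> rmat" where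
  "edge_matrix x = (\<lambda>i j. of_bool (x (min i j, max i j)))"

lemma observation_pmf_eq:
  "observation_pmf n Theta P = map_pmf (map_prod edge_matrix edge_matrix)
     (observed_edges (node_pairs n) (\<lambda>(i, j). Theta i j) (\<lambda>(i, j). P i j))"
  unfolding observation_pmf_def bernoulli_sym_pmf_def observed_edges_def edge_matrix_def
  by (simp add: map_pair[symmetric] map_prod_def split_def)

text \<open>
  For a 0/1 observation the divergence is the negative log-likelihood. The likelihood criterion is
  therefore, up to the term of the truth that does not depend on the candidate, the \<open>log_loss\<close>
  of the candidate; the next lemma gives that decomposition.
\<close>

lemma kl_weighted_edge_matrix:
  assumes "\<And>i j. (i, j) \<in> node_pairs n \<Longrightarrow> 0 < M i j \<and> M i j < 1"
  shows "kl_weighted n (edge_matrix x) (edge_matrix a) M =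
    ereal (observed_sum (node_pairs n) (\<lambda>(i, j) b. - ln (if b then M i j else 1 - M i j)) (a, x))"
  unfolding kl_weighted_def observed_sum_def sum_ereal[symmetric]
proof (intro sum.cong refl)
  fix e assume e: "e \<in> node_pairs n"
  obtain i j where ij: "e = (i, j)" by fastforce
  have "min i j = i" "max i j = j" using e by (auto simp: ij node_pairs_def)
  thus "(case e of (i, j) \<Rightarrow> ereal (edge_matrix x i j) * kl_bernoulli (edge_matrix a i j) (M i j)) =
      ereal (of_bool (snd (a, x) e) * (case e of (i, j) \<Rightarrow> \<lambda>b. - ln (if b then M i j else 1 - M i j)) (fst (a, x) e))"
    using assms[of i j] e
    by (auto simp: ij edge_matrix_def kl_bernoulli_def kl_term_def ln_div)
qed

lemma (in observed_network) log_loss_eq: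
  assumes "\<And>e. e \<in> E \<Longrightarrow> 0 < q e \<and> q e < 1"
  shows "log_loss q \<omega> = observed_sum E (\<lambda>e b. - ln (if b then q e else 1 - q e)) \<omega>
     - observed_sum E (\<lambda>e b. - ln (if b then \<theta> e else 1 - \<theta> e)) \<omega>"
  unfolding log_loss_def observed_sum_def sum_subtractf[symmetric]
proof (intro sum.cong refl)
  fix e assume "e \<in> E"
  thus "of_bool (snd \<omega> e) * log_lik_ratio (\<theta> e) (q e) (fst \<omega> e) =
     of_bool (snd \<omega> e) * - ln (if fst \<omega> e then q e else 1 - q e) - of_bool (snd \<omega> e) * - ln (if fst \<omega> e then \<theta> e else 1 - \<theta> e)"
    using assms[of e] \<theta>_unit[of e] by (simp add: log_lik_ratio_def ln_div algebra_simps)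
qed

text \<open>
  Symmetric matrices depend only on the unordered pair of labels, represented here by its sorted
  version. All \<open>k\<^sup>2\<close> ordered pairs serve as block names, and the those on and above the diagonal
  occur as values.
\<close>

definition node_block :: "(nat \<Rightarrow> nat) \<Rightarrow> nat \<times> nat \<Rightarrow> nat \<times> nat" where
  "node_block z = (\<lambda>(i, j). (min (z i) (z j), max (z i) (z j)))"

section \<open>Risk of the restricted maximum likelihood estimator\<close>

text \<open>
  The non-asymptotic bound at a fixed number of nodes, for any competitor \<open>(Qs, zs)\<close> with entries in
  \<open>[0, 1]\<close>. The deviation level is \<open>2 n ln k\<close> for each labelling, of which the union over the
  \<open>k ^ n\<close> labellings uses up \<open>n ln k\<close>, and \<open>n ln k\<close> for the competitor.
\<close>

lemma restricted_mle_bound: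
  fixes \<gamma> \<rho> :: real
  assumes n: "node_pairs n \<noteq> {}" and k: "1 \<le> k"
    and P: "P \<in> sym_mats n {0..1}"
    and Theta: "\<And>i j. (i, j) \<in> node_pairs n \<Longrightarrow> 0 < \<gamma> \<and> \<gamma> \<le> Theta i j \<and> Theta i j \<le> \<rho> \<and> \<rho> < 1"
    and Qs: "Qs \<in> sym_mats k {0..1}" and zs: "zs \<in> labellings n k"
    and mle: "\<And>A X. (A, X) \<in> set_pmf (observation_pmf n Theta P) \<Longrightarrow>
      is_restricted_mle n k \<gamma> \<rho> A X (Qh A X, zh A X)"
  shows "1 - 3 * exp (- (real n * ln (real k))) \<le> measure_pmf.prob (observation_pmf n Theta P)
     {(A, X). ereal (weighted_norm_sq n P (\<lambda>i j. Theta i j - block_matrix (Qh A X) (zh A X) i j))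
        \<le> ereal (2272 * \<rho>) * (kl_weighted n P Theta (block_matrix Qs zs) +
            ereal (\<rho>\<^sup>2 / min ((1 - \<rho>)\<^sup>2) (\<gamma>\<^sup>2) * ((real k)\<^sup>2 + real n * ln (real k))))}"
    (is "_ \<le> measure_pmf.prob _ ?good")
proof -
  let ?E = "node_pairs n" and ?th = "\<lambda>(i, j). Theta i j" and ?pi = "\<lambda>(i, j). P i j"
  let ?B = "{1..k} \<times> {1..k}"
  have \<gamma>\<rho>: "0 < \<gamma>" "\<gamma> \<le> \<rho>" "\<rho> < 1" using n Theta by force+
  interpret observed_network ?E ?th ?pi \<gamma> \<rho>
  proof
    fix e assume "e \<in> ?E"
    then obtain i j where e: "e = (i, j)" "(i, j) \<in> ?E" by (cases e) auto
    show "?th e \<in> {\<gamma>..\<rho>}" using Theta[OF e(2)] e by simp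
    have "i \<in> {1..n}" "j \<in> {1..n}" using e(2) by (auto simp: node_pairs_def)
    thus "?pi e \<in> {0..1}" using P e unfolding sym_mats_def by auto
  qed (use \<gamma>\<rho> in auto)
  let ?M = "observed_edges ?E ?th ?pi"
  define L where "L = real n * ln (real k)"
  have L0: "0 \<le> L" using k by (simp add: L_def)
  \<comment> \<open>The competitor: the oracle clipped to the range over which the estimator minimises.\<close>
  define Qc where "Qc a b = clip \<gamma> \<rho> (Qs a b)" for a b
  define qc where "qc = (\<lambda>(i, j). Qc (zs i) (zs j))"
  have node: "i \<in> {1..n} \<and> j \<in> {1..n}" if "(i, j) \<in> ?E" for i j
    using that by (auto simp: node_pairs_def)
  have Qc_feasible: "Qc \<in> sym_mats k {\<gamma>..\<rho>}"
    using Qs \<gamma>\<rho> by (auto simp: sym_mats_def Qc_def clip_def)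
  have entry: "Q (z i) (z j) \<in> S" if "Q \<in> sym_mats k S" "z \<in> labellings n k" "(i, j) \<in> ?E" for Q z i j S
  proof -
    have "z i \<in> {1..k}" "z j \<in> {1..k}" using that(2) node[OF that(3)] by (auto simp: labellings_def)
    thus ?thesis using that(1) by (auto simp: sym_mats_def)
  qed
  have qc_range: "qc e \<in> {\<gamma>..\<rho>}" if "e \<in> ?E" for e
    using that entry[OF Qc_feasible zs] by (cases e) (auto simp: qc_def)
  define K where "K = kl_weighted n P Theta (block_matrix Qs zs)"
  have kl_oracle: "ereal (kl_risk qc) \<le> K"
    unfolding kl_risk_def K_def kl_weighted_def sum_ereal[symmetric]
  proof (rule sum_mono)
    fix e assume e': "e \<in> ?E"
    obtain i j where e: "e = (i, j)" "(i, j) \<in> ?E" using e' by (cases e) auto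
    have "i \<noteq> j" using e(2) by (auto simp: node_pairs_def)
    moreover have "ereal (kl_div (Theta i j) (qc e)) \<le> kl_bernoulli (Theta i j) (Qs (zs i) (zs j))"
      unfolding qc_def Qc_def e(1) prod.case
      using entry[OF Qs zs e(2)] Theta[OF e(2)] by (intro kl_div_clip_le) auto
    moreover have "0 \<le> P i j" using \<pi>_range[OF e'] e(1) by simp
    ultimately show "ereal (?pi e * kl_div (?th e) (qc e))
        \<le> (case e of (i, j) \<Rightarrow> ereal (P i j) * kl_bernoulli (Theta i j) (block_matrix Qs zs i j))"
      unfolding e(1) prod.case block_matrix_def times_ereal.simps(1)[symmetric]
      by (simp only: if_False) (intro ereal_mult_left_mono; simp)
  qed
  define Z where "Z = PiE {1..n} (\<lambda>_. {1..k})"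
  have Z: "finite Z" "card Z = k ^ n" by (auto simp: Z_def card_PiE intro!: finite_PiE)
  define bad where "bad z = {\<omega>. \<exists>q. (\<forall>b\<in>?B. q b \<in> {\<gamma>..\<rho>}) \<and>
      16 * \<rho> * log_loss (q \<circ> node_block z) \<omega> + 1128 * \<rho> * \<kappa> * (real (card ?B) + 2 * L)
        < (\<Sum>e\<in>?E. ?pi e * (?th e - q (node_block z e))\<^sup>2)}" for z
  define bad0 where "bad0 = {\<omega>. 5 * kl_risk qc + \<kappa> * L \<le> log_loss qc \<omega>}"
  have bad_z: "prob (bad z) \<le> 2 * exp (- (2 * L))" if "z \<in> Z" for z
  proof -
    interpret blocked_network ?E ?th ?pi \<gamma> \<rho> ?B "node_block z"
    proof
      fix e assume "e \<in> ?E"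
      then obtain i j where e: "e = (i, j)" "(i, j) \<in> ?E" by (cases e) auto
      have "z i \<in> {1..k}" "z j \<in> {1..k}" using \<open>z \<in> Z\<close> node[OF e(2)] by (auto simp: Z_def)
      thus "node_block z e \<in> ?B" by (auto simp: e node_block_def min_def max_def)
    qed auto
    show ?thesis unfolding bad_def using L0 by (intro uniform_risk_bound) auto
  qed
  have "prob ((\<Union>z\<in>Z. bad z) \<union> bad0) \<le> prob (\<Union>z\<in>Z. bad z) + prob bad0" by (intro measure_Un_le) auto
  also have "prob (\<Union>z\<in>Z. bad z) \<le> (\<Sum>z\<in>Z. prob (bad z))" using Z by (intro measure_UNION_le) auto
  also have "\<dots> \<le> (\<Sum>z\<in>Z. 2 * exp (- (2 * L)))" by (intro sum_mono bad_z)
  also have "\<dots> = 2 * exp (- L)"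
  proof -
    have "real (k ^ n) = exp L" using k by (simp add: L_def exp_of_nat_mult)
    hence "(\<Sum>z\<in>Z. 2 * exp (- (2 * L))) = 2 * (exp L * exp (- (2 * L)))" by (simp add: Z)
    thus ?thesis by (simp add: exp_add[symmetric])
  qed
  also have "prob bad0 \<le> exp (- L)"
    unfolding bad0_def by (intro log_loss_upper_tail qc_range)
  finally have bad: "prob ((\<Union>z\<in>Z. bad z) \<union> bad0) \<le> 3 * exp (- L)" by simp
  let ?f = "map_prod edge_matrix edge_matrix"
  have "set_pmf ?M \<subseteq> ?f -` ?good \<union> ((\<Union>z\<in>Z. bad z) \<union> bad0)"
  proof (rule subsetI, rule UnCI)
    fix \<omega> assume supp: "\<omega> \<in> set_pmf ?M" and nbad: "\<omega> \<notin> (\<Union>z\<in>Z. bad z) \<union> bad0"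
    obtain a x where \<omega>: "\<omega> = (a, x)" by fastforce
    define A where "A = edge_matrix a"
    define X where "X = edge_matrix x"
    define Q where "Q = Qh A X"
    \<comment> \<open>Labellings are unconstrained outside \<open>{1..n}\<close>; restriction leaves finitely many.\<close>
    define z where "z = restrict (zh A X) {1..n}"
    have "(A, X) \<in> set_pmf (observation_pmf n Theta P)"
      using supp by (force simp: observation_pmf_eq \<omega> A_def X_def)
    from mle[OF this] have opt: "Q \<in> sym_mats k {\<gamma>..\<rho>}" "zh A X \<in> labellings n k"
      and min: "kl_weighted n X A (\<lambda>i j. Q (zh A X i) (zh A X j)) \<le> kl_weighted n X A (\<lambda>i j. Qc (zs i) (zs j))"
      using Qc_feasible zs by (auto simp: is_restricted_mle_def is_arg_min_def Q_def not_less)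
    have z: "z \<in> Z" using opt(2) by (auto simp: z_def Z_def labellings_def)
    define q where "q = case_prod Q"
    have q: "\<forall>b\<in>?B. q b \<in> {\<gamma>..\<rho>}" using opt(1) by (auto simp: q_def sym_mats_def)
    have q_eq: "q (node_block z (i, j)) = Q (zh A X i) (zh A X j)" if "(i, j) \<in> ?E" for i j
    proof -
      have "zh A X i \<in> {1..k}" "zh A X j \<in> {1..k}" "z i = zh A X i" "z j = zh A X j"
        using opt(2) node[OF that] by (auto simp: labellings_def z_def)
      thus ?thesis using opt(1) by (auto simp: q_def node_block_def min_def max_def sym_mats_def)
    qed
    have q_unit: "0 < q (node_block z e) \<and> q (node_block z e) < 1" if "e \<in> ?E" for e
      using that entry[OF opt] \<gamma>\<rho> by (cases e) (force simp: q_eq)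
    have qc_unit: "0 < qc e \<and> qc e < 1" if "e \<in> ?E" for e
      using unit_range qc_range[OF that] by blast
    have "log_loss (q \<circ> node_block z) \<omega> \<le> log_loss qc \<omega>"
    proof -
      have "kl_weighted n X A (\<lambda>i j. Q (zh A X i) (zh A X j))
         = ereal (observed_sum ?E (\<lambda>(i, j) b. - ln (if b then Q (zh A X i) (zh A X j) else 1 - Q (zh A X i) (zh A X j))) \<omega>)"
        using q_unit q_eq unfolding A_def X_def \<omega>
        by (intro kl_weighted_edge_matrix) force
      also have "\<dots> = ereal (observed_sum ?E (\<lambda>e b. - ln (if b then q (node_block z e) else 1 - q (node_block z e))) \<omega>)"
        unfolding observed_sum_def by (intro arg_cong[of _ _ ereal] sum.cong refl) (auto simp: q_eq)
      finally have 1: "kl_weighted n X A (\<lambda>i j. Q (zh A X i) (zh A X j)) = \<dots>" .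
      have "kl_weighted n X A (\<lambda>i j. Qc (zs i) (zs j))
         = ereal (observed_sum ?E (\<lambda>(i, j) b. - ln (if b then Qc (zs i) (zs j) else 1 - Qc (zs i) (zs j))) \<omega>)"
        using qc_unit unfolding A_def X_def \<omega>
        by (intro kl_weighted_edge_matrix) (force simp: qc_def)
      also have "\<dots> = ereal (observed_sum ?E (\<lambda>e b. - ln (if b then qc e else 1 - qc e)) \<omega>)"
        unfolding observed_sum_def by (intro arg_cong[of _ _ ereal] sum.cong refl) (auto simp: qc_def)
      finally have 2: "kl_weighted n X A (\<lambda>i j. Qc (zs i) (zs j)) = \<dots>" .
      show ?thesis
        using min log_loss_eq[of "\<lambda>e. q (node_block z e)" \<omega>, OF q_unit] log_loss_eq[of qc \<omega>, OF qc_unit]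
        unfolding 1 2 o_def by simp
    qed
    also have "log_loss qc \<omega> \<le> 5 * kl_risk qc + \<kappa> * L" using nbad by (auto simp: bad0_def)
    finally have loss: "16 * \<rho> * log_loss (q \<circ> node_block z) \<omega> \<le> 16 * \<rho> * (5 * kl_risk qc + \<kappa> * L)"
      using \<rho>_pos by (intro mult_left_mono) auto
    have "0 \<le> kl_risk qc" unfolding kl_risk_def
      using \<theta>_unit qc_unit \<pi>_range by (intro sum_nonneg mult_nonneg_nonneg kl_div_nonneg) auto
    \<comment> \<open>The coefficients that arise are 16 * 5 = 80 for the divergence, 1128 for \<open>k\<^sup>2\<close>, and
        2 * 1128 + 16 = 2272 for \<open>n ln k\<close>; the largest serves for all.\<close>
    hence "80 * (\<rho> * kl_risk qc) \<le> 2272 * (\<rho> * kl_risk qc)"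
      using \<rho>_pos by (intro mult_right_mono) auto
    moreover have "1128 * (\<rho> * \<kappa> * (real k)\<^sup>2) \<le> 2272 * (\<rho> * \<kappa> * (real k)\<^sup>2)"
      using \<rho>_pos \<kappa>_bounds(1) by (intro mult_right_mono) auto
    moreover have "weighted_norm_sq n P (\<lambda>i j. Theta i j - block_matrix Q (zh A X) i j)
       = (\<Sum>e\<in>?E. ?pi e * (?th e - q (node_block z e))\<^sup>2)"
      unfolding weighted_norm_sq_def
      by (intro sum.cong refl) (auto simp: q_eq block_matrix_def node_pairs_def)
    moreover have "\<omega> \<notin> bad z" using nbad z by blast
    hence "(\<Sum>e\<in>?E. ?pi e * (?th e - q (node_block z e))\<^sup>2) \<le>
       16 * \<rho> * log_loss (q \<circ> node_block z) \<omega> + 1128 * \<rho> * \<kappa> * ((real k)\<^sup>2 + 2 * L)"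
      using q by (auto simp: bad_def not_less card_cartesian_product power2_eq_square)
    ultimately have "weighted_norm_sq n P (\<lambda>i j. Theta i j - block_matrix Q (zh A X) i j)
       \<le> 2272 * \<rho> * (kl_risk qc + \<kappa> * ((real k)\<^sup>2 + L))"
      using loss by (simp add: algebra_simps)
    hence "ereal (weighted_norm_sq n P (\<lambda>i j. Theta i j - block_matrix Q (zh A X) i j))
       \<le> ereal (2272 * \<rho>) * (ereal (kl_risk qc) + ereal (\<kappa> * ((real k)\<^sup>2 + L)))" by simp
    also have "\<dots> \<le> ereal (2272 * \<rho>) * (K + ereal (\<kappa> * ((real k)\<^sup>2 + L)))"
      using \<rho>_pos by (intro ereal_mult_left_mono add_right_mono kl_oracle) auto
    finally show "\<omega> \<in> ?f -` ?good"
      by (simp add: \<omega> A_def X_def Q_def K_def \<kappa>_def L_def)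
  qed
  hence "prob (set_pmf ?M) \<le> prob (?f -` ?good \<union> ((\<Union>z\<in>Z. bad z) \<union> bad0))"
    by (intro measure_pmf.finite_measure_mono) auto
  also have "\<dots> \<le> prob (?f -` ?good) + prob ((\<Union>z\<in>Z. bad z) \<union> bad0)" by (intro measure_Un_le) auto
  also have "prob (set_pmf ?M) = 1" by (simp add: measure_def emeasure_pmf)
  finally have "1 - 3 * exp (- L) \<le> prob (?f -` ?good)" using bad by linarith
  thus ?thesis unfolding observation_pmf_eq measure_map_pmf L_def .
qed

theorem theorem1:
  "\<exists>C>0::real. \<exists>C'>0::real.
     \<forall>(k :: nat \<Rightarrow> nat) (\<gamma> :: nat \<Rightarrow> real) (\<rho> :: nat \<Rightarrow> real)
       (Theta :: nat \<Rightarrow> rmat) (P :: nat \<Rightarrow> rmat)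
       (Qs :: nat \<Rightarrow> rmat) (zs :: nat \<Rightarrow> nat \<Rightarrow> nat)
       (Qh :: nat \<Rightarrow> rmat \<Rightarrow> rmat \<Rightarrow> rmat) (zh :: nat \<Rightarrow> rmat \<Rightarrow> rmat \<Rightarrow> nat \<Rightarrow> nat).
       (\<forall>n\<ge>1. k n \<ge> 1) \<longrightarrow>
       (\<forall>n\<ge>1. Theta n \<in> sym_mats n {0..1} \<and> (\<forall>i\<in>{1..n}. Theta n i i = 0)) \<longrightarrow>
       (\<forall>n\<ge>1. P n \<in> sym_mats n {0..1}) \<longrightarrow>
       (\<forall>n\<ge>1. \<forall>(i, j)\<in>node_pairs n.
          0 < \<gamma> n \<and> \<gamma> n \<le> Theta n i j \<and> Theta n i j \<le> \<rho> n \<and> \<rho> n < 1) \<longrightarrow>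
       filterlim (\<lambda>n. \<rho> n / (1 / real n)) at_top sequentially \<longrightarrow>
       (\<forall>n\<ge>1. is_oracle n (k n) (P n) (Theta n) (Qs n, zs n)) \<longrightarrow>
       (\<forall>n\<ge>1. \<forall>(A, X)\<in>set_pmf (observation_pmf n (Theta n) (P n)).
          is_restricted_mle n (k n) (\<gamma> n) (\<rho> n) A X (Qh n A X, zh n A X)) \<longrightarrow>
       (\<forall>n\<ge>1.
          measure_pmf.prob (observation_pmf n (Theta n) (P n))
            {(A, X).
               ereal (weighted_norm_sq n (P n)
                        (\<lambda>i j. Theta n i j - block_matrix (Qh n A X) (zh n A X) i j))
               \<le> ereal (C' * \<rho> n) *
                  (kl_weighted n (P n) (Theta n) (block_matrix (Qs n) (zs n)) +
                   ereal ((\<rho> n)\<^sup>2 / min ((1 - \<rho> n)\<^sup>2) ((\<gamma> n)\<^sup>2) *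
                          ((real (k n))\<^sup>2 + real n * ln (real (k n)))))}
          \<ge> 1 - 9 * exp (- C * \<rho> n * real n * ln (real (k n))))"
proof (rule exI[of _ 1], rule conjI, simp, rule exI[of _ 2272], rule conjI, simp, intro allI impI, goal_cases)
  case (1 k \<gamma> \<rho> Theta P Qs zs Qh zh n)
  have k: "1 \<le> k n" and l: "0 \<le> ln (real (k n))" using 1 by auto
  show ?case
  proof (cases "node_pairs n = {}")
    \<comment> \<open>With a single node there are no pairs, and the range constraint on \<open>\<rho> n\<close> is void. If
        \<open>\<rho> n\<close> is negative, so may be the risk bound, but then the claimed probability is too.\<close>
    case True
    show ?thesis
    proof (cases "0 \<le> \<rho> n")
      case pos: True
      have "0 \<le> ereal (2272 * \<rho> n) * (0 + ereal ((\<rho> n)\<^sup>2 / min ((1 - \<rho> n)\<^sup>2) ((\<gamma> n)\<^sup>2) *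
                          ((real (k n))\<^sup>2 + real n * ln (real (k n)))))"
        using pos l by simp
      thus ?thesis using True by (simp add: weighted_norm_sq_def kl_weighted_def)
    next
      case False
      hence "0 \<le> - 1 * \<rho> n * real n * ln (real (k n))" using l
        by (simp add: mult_nonpos_nonneg mult_le_0_iff)
      hence "1 \<le> exp (- 1 * \<rho> n * real n * ln (real (k n)))" by simp
      hence "1 - 9 * exp (- 1 * \<rho> n * real n * ln (real (k n))) \<le> 0" by linarith
      thus ?thesis using measure_nonneg order_trans by blast
    qed
  next
    case False
    then obtain i j where "(i, j) \<in> node_pairs n" by (auto simp: ex_in_conv[symmetric] simp del: ex_in_conv)
    hence r: "\<rho> n < 1" using 1 by fastforce
    have Qs_zs: "Qs n \<in> sym_mats (k n) {0..1}" "zs n \<in> labellings n (k n)"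
      using 1 by (auto simp: is_oracle_def is_arg_min_def)
    have "\<rho> n * (real n * ln (real (k n))) \<le> 1 * (real n * ln (real (k n)))"
      using r l by (intro mult_right_mono) auto
    hence "exp (- (real n * ln (real (k n)))) \<le> exp (- 1 * \<rho> n * real n * ln (real (k n)))"
      by (simp add: mult_ac)
    hence "1 - 9 * exp (- 1 * \<rho> n * real n * ln (real (k n))) \<le> 1 - 3 * exp (- (real n * ln (real (k n))))"
      using exp_gt_zero[of "- (real n * ln (real (k n)))"] by linarith
    also have "\<dots> \<le> measure_pmf.prob (observation_pmf n (Theta n) (P n))
            {(A, X).
               ereal (weighted_norm_sq n (P n)
                        (\<lambda>i j. Theta n i j - block_matrix (Qh n A X) (zh n A X) i j))
               \<le> ereal (2272 * \<rho> n) *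
                  (kl_weighted n (P n) (Theta n) (block_matrix (Qs n) (zs n)) +
                   ereal ((\<rho> n)\<^sup>2 / min ((1 - \<rho> n)\<^sup>2) ((\<gamma> n)\<^sup>2) *
                          ((real (k n))\<^sup>2 + real n * ln (real (k n)))))}"
      by (rule restricted_mle_bound) (use False k Qs_zs 1 in auto)
    finally show ?thesis .
  qed
qed

end
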